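(* Let $\varepsilon\in\{1,-1\}$, let $S$ be an orientable surface and let $\psi:S\to\mathbb{M}^2(\varepsilon)\times\mathbb{R}$ be an immersion of positive constant Gaussian curvature $K(I)$ such that $K(I)-\varepsilon>0$. Consider $S$ as a Riemann surface with the conformal structure induced by its second fundamental form $II$. Then $$Q=\left(\langle\psi_z,\psi_z\rangle+\frac{1}{\varepsilon K(I)-1}\,h_z^2\right)dz^2$$ is a holomorphic quadratic form on $S$, where $z$ denotes a local conformal parameter on $S$ and $h$ is the height function of $\psi$.
   Context: $\mathbb{M}^2(1)=\mathbb{S}^2$ is the unit sphere (curvature $1$) and $\mathbb{M}^2(-1)=\mathbb{H}^2$ the hyperbolic plane (curvature $-1$); $\mathbb{M}^2(\varepsilon)\times\mathbb{R}$ carries the product metric and is viewed as a submanifold of $\mathbb{R}^4$ with the metric $\langle\,,\rangle=\varepsilon\,dx_1^2+dx_2^2+dx_3^2+dx_4^2$, namely $\{x_1^2+x_2^2+x_3^2=1\}$ if $\varepsilon=1$ and $\{-x_1^2+x_2^2+x_3^2=-1,\ x_1>0\}$ if $\varepsilon=-1$. For an immersion $\psi$ with unit normal field $N$ (tangent to the ambient space), $I=\langle d\psi,d\psi\rangle$, $II=\langle -dN,d\psi\rangle$, $K(I)$ is the intrinsic Gaussian curvature of $I$, and $h=x_4\circ\psi$ is the height function. Under the hypotheses, $II$ is definite, so $II$ or $-II$ is a Riemannian metric, and the conformal structure induced by $II$ is that of this metric. For a local conformal parameter $z=s+it$ for this structure, $\partial_z=\frac12(\partial_s-i\partial_t)$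 and $\langle\,,\rangle$ is extended complex bilinearly. *)

theory Defs
  imports "HOL-Analysis.Analysis"
begin

section \<open>Smooth maps and smooth surfaces\<close>

definition pd :: "complex \<Rightarrow> (complex \<Rightarrow> 'b::real_normed_vector) \<Rightarrow> complex \<Rightarrow> 'b" where
  "pd u f w = frechet_derivative f (at w) u"

text \<open>\<open>Ck_on\<close> and \<open>smooth_on\<close> are meant for open sets \<open>D\<close>.\<close>

fun Ck_on :: "nat \<Rightarrow> (complex \<Rightarrow> 'b::real_normed_vector) \<Rightarrow> complex set \<Rightarrow> bool" where
  "Ck_on 0 f D \<longleftrightarrow> continuous_on D f"
| "Ck_on (Suc k) f D \<longleftrightarrow> f differentiable_on D \<and> (\<forall>u. Ck_on k (pd u f) D)"

definition smooth_on :: "(complex \<Rightarrow> 'b::real_normed_vector) \<Rightarrow> complex set \<Rightarrow> bool" where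
  "smooth_on f D \<longleftrightarrow> (\<forall>k. Ck_on k f D)"

text \<open>A chart is a pair of a domain and a coordinate map. The coordinate plane is the type
  \<open>complex\<close>, with the coordinates \<open>(s, t)\<close> written \<open>s + \<i> t\<close>; thus the
  coordinate vector fields are \<open>1\<close> (for \<open>s\<close>) and \<open>\<i>\<close> (for \<open>t\<close>). The values of
  the coordinate map outside the domain are irrelevant.\<close>

type_synonym 'a chart = "'a set \<times> ('a \<Rightarrow> complex)"

definition chart_image :: "'a chart \<Rightarrow> complex set" where
  "chart_image c = snd c ` fst c"

definition in_chart :: "'a chart \<Rightarrow> ('a \<Rightarrow> 'b) \<Rightarrow> complex \<Rightarrow> 'b" where
  "in_chart c f = f \<circ> inv_into (fst c) (snd c)"

definition is_chart :: "'a topology \<Rightarrow> 'a chart \<Rightarrow> bool" where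
  "is_chart X c \<longleftrightarrow> openin X (fst c) \<and> open (chart_image c) \<and>
     homeomorphic_map (subtopology X (fst c)) (top_of_set (chart_image c)) (snd c)"

definition overlap :: "'a chart \<Rightarrow> 'a chart \<Rightarrow> complex set" where
  "overlap c d = snd c ` (fst c \<inter> fst d)"

definition transition :: "'a chart \<Rightarrow> 'a chart \<Rightarrow> complex \<Rightarrow> complex" where
  "transition c d = in_chart c (snd d)"

definition smoothly_compatible :: "'a chart \<Rightarrow> 'a chart \<Rightarrow> bool" where
  "smoothly_compatible c d \<longleftrightarrow>
     smooth_on (transition c d) (overlap c d) \<and> smooth_on (transition d c) (overlap d c)"

text \<open>The smooth structure is given by its maximal atlas.\<close>

definition smooth_surface :: "'a topology \<Rightarrow> 'a chart set \<Rightarrow> bool" where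
  "smooth_surface X A \<longleftrightarrow>
     Hausdorff_space X \<and> second_countable X \<and>
     (\<forall>c\<in>A. is_chart X c) \<and> (\<Union>c\<in>A. fst c) = topspace X \<and>
     (\<forall>c\<in>A. \<forall>d\<in>A. smoothly_compatible c d) \<and>
     (\<forall>c. is_chart X c \<and> (\<forall>d\<in>A. smoothly_compatible c d) \<longrightarrow> c \<in> A)"

definition jacobian :: "(complex \<Rightarrow> complex) \<Rightarrow> complex \<Rightarrow> real" where
  "jacobian f w = Re (pd 1 f w) * Im (pd \<i> f w) - Im (pd 1 f w) * Re (pd \<i> f w)"

definition positively_compatible :: "'a chart \<Rightarrow> 'a chart \<Rightarrow> bool" where
  "positively_compatible c d \<longleftrightarrow> (\<forall>w\<in>overlap c d. jacobian (transition c d) w > 0)"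

text \<open>The surface is orientable iff some \<open>B\<close> with \<open>orientation X A B\<close> exists; such
  a \<open>B\<close> is a choice of orientation.\<close>

definition orientation :: "'a topology \<Rightarrow> 'a chart set \<Rightarrow> 'a chart set \<Rightarrow> bool" where
  "orientation X A B \<longleftrightarrow> B \<subseteq> A \<and> (\<Union>c\<in>B. fst c) = topspace X \<and>
     (\<forall>c\<in>B. \<forall>d\<in>B. positively_compatible c d)"

section \<open>Intrinsic Gaussian curvature of a metric on a coordinate domain\<close>

text \<open>A metric \<open>g\<close> on an open subset of the coordinate plane is given by the bilinear forms
  \<open>g w\<close>. For constant vector fields \<open>u\<close>, \<open>v\<close> (which commute), \<open>christoffel g w u v\<close> is the
  Levi-Civita derivative of \<open>v\<close> along \<open>u\<close> at \<open>w\<close>, characterised by Koszul's formula; its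
  components for \<open>u, v \<in> {1, \<i>}\<close> are the Christoffel symbols.\<close>

definition christoffel ::
  "(complex \<Rightarrow> complex \<Rightarrow> complex \<Rightarrow> real) \<Rightarrow> complex \<Rightarrow> complex \<Rightarrow> complex \<Rightarrow> complex" where
  "christoffel g w u v = (THE y. \<forall>x.
     2 * g w y x = pd u (\<lambda>z. g z v x) w + pd v (\<lambda>z. g z u x) w - pd x (\<lambda>z. g z u v) w)"

text \<open>\<open>R(u,v)x = \<nabla>\<^sub>u \<nabla>\<^sub>v x - \<nabla>\<^sub>v \<nabla>\<^sub>u x\<close> for constant vector fields.\<close>

definition riemann_tensor ::
  "(complex \<Rightarrow> complex \<Rightarrow> complex \<Rightarrow> real) \<Rightarrow> complex \<Rightarrow> complex \<Rightarrow> complex \<Rightarrow> complex \<Rightarrow> complex" where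
  "riemann_tensor g w u v x =
     (pd u (\<lambda>z. christoffel g z v x) w + christoffel g w u (christoffel g w v x)) -
     (pd v (\<lambda>z. christoffel g z u x) w + christoffel g w v (christoffel g w u x))"

definition gauss_curvature :: "(complex \<Rightarrow> complex \<Rightarrow> complex \<Rightarrow> real) \<Rightarrow> complex \<Rightarrow> real" where
  "gauss_curvature g w =
     g w (riemann_tensor g w 1 \<i> \<i>) 1 / (g w 1 1 * g w \<i> \<i> - (g w 1 \<i>)\<^sup>2)"

section \<open>The ambient space and immersed surfaces\<close>

text \<open>The form is polymorphic in the scalars: on \<open>real ^ 4\<close> it is the ambient metric, and on
  \<open>complex ^ 4\<close> it is the complex bilinear extension of the latter.\<close>

definition form :: "real \<Rightarrow> 'k::real_algebra_1 ^ 4 \<Rightarrow> 'k ^ 4 \<Rightarrow> 'k" where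
  "form \<epsilon> x y = of_real \<epsilon> * x $ 1 * y $ 1 + x $ 2 * y $ 2 + x $ 3 * y $ 3 + x $ 4 * y $ 4"

definition ambient :: "real \<Rightarrow> (real ^ 4) set" where
  "ambient \<epsilon> = {x. \<epsilon> * (x $ 1)\<^sup>2 + (x $ 2)\<^sup>2 + (x $ 3)\<^sup>2 = \<epsilon> \<and> (\<epsilon> = -1 \<longrightarrow> x $ 1 > 0)}"

definition tangent_ambient :: "real \<Rightarrow> real ^ 4 \<Rightarrow> (real ^ 4) set" where
  "tangent_ambient \<epsilon> x = {v. \<epsilon> * x $ 1 * v $ 1 + x $ 2 * v $ 2 + x $ 3 * v $ 3 = 0}"

definition smooth_map :: "'a chart set \<Rightarrow> ('a \<Rightarrow> 'b::real_normed_vector) \<Rightarrow> bool" where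
  "smooth_map A f \<longleftrightarrow> (\<forall>c\<in>A. smooth_on (in_chart c f) (chart_image c))"

definition immersion :: "'a topology \<Rightarrow> 'a chart set \<Rightarrow> real \<Rightarrow> ('a \<Rightarrow> real ^ 4) \<Rightarrow> bool" where
  "immersion X A \<epsilon> \<psi> \<longleftrightarrow> \<psi> ` topspace X \<subseteq> ambient \<epsilon> \<and> smooth_map A \<psi> \<and>
     (\<forall>c\<in>A. \<forall>w\<in>chart_image c. inj (\<lambda>u. pd u (in_chart c \<psi>) w))"

definition unit_normal ::
  "'a topology \<Rightarrow> 'a chart set \<Rightarrow> real \<Rightarrow> ('a \<Rightarrow> real ^ 4) \<Rightarrow> ('a \<Rightarrow> real ^ 4) \<Rightarrow> bool" where
  "unit_normal X A \<epsilon> \<psi> N \<longleftrightarrow> smooth_map A N \<and>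
     (\<forall>p\<in>topspace X. N p \<in> tangent_ambient \<epsilon> (\<psi> p) \<and> form \<epsilon> (N p) (N p) = 1) \<and>
     (\<forall>c\<in>A. \<forall>w\<in>chart_image c. \<forall>u. form \<epsilon> (pd u (in_chart c \<psi>) w) (in_chart c N w) = 0)"

text \<open>Coordinate expressions of the fundamental forms \<open>I\<close> and \<open>II\<close>.\<close>

definition first_form ::
  "real \<Rightarrow> ('a \<Rightarrow> real ^ 4) \<Rightarrow> 'a chart \<Rightarrow> complex \<Rightarrow> complex \<Rightarrow> complex \<Rightarrow> real" where
  "first_form \<epsilon> \<psi> c w u v = form \<epsilon> (pd u (in_chart c \<psi>) w) (pd v (in_chart c \<psi>) w)"

definition second_form ::
  "real \<Rightarrow> ('a \<Rightarrow> real ^ 4) \<Rightarrow> ('a \<Rightarrow> real ^ 4) \<Rightarrow> 'a chart \<Rightarrow> complex \<Rightarrow> complex \<Rightarrow> complex \<Rightarrow> real" where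
  "second_form \<epsilon> \<psi> N c w u v = form \<epsilon> (- pd u (in_chart c N) w) (pd v (in_chart c \<psi>) w)"

definition constant_curvature ::
  "'a chart set \<Rightarrow> real \<Rightarrow> ('a \<Rightarrow> real ^ 4) \<Rightarrow> real \<Rightarrow> bool" where
  "constant_curvature A \<epsilon> \<psi> K \<longleftrightarrow>
     (\<forall>c\<in>A. \<forall>w\<in>chart_image c. gauss_curvature (first_form \<epsilon> \<psi> c) w = K)"

section \<open>The conformal structure of the second fundamental form\<close>

text \<open>Local conformal parameters \<open>z = s + \<i> t\<close>: charts of the smooth structure, compatible with
  the orientation, in which \<open>II = r (ds\<^sup>2 + dt\<^sup>2)\<close> with \<open>r\<close> nonzero. The sign of \<open>r\<close> is that of
  the definite form \<open>II\<close>, so the parameters are conformal for the Riemannian metric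
  \<open>II\<close> or \<open>- II\<close>.\<close>

definition conformal_parameters ::
  "'a chart set \<Rightarrow> 'a chart set \<Rightarrow> real \<Rightarrow> ('a \<Rightarrow> real ^ 4) \<Rightarrow> ('a \<Rightarrow> real ^ 4) \<Rightarrow> 'a chart set" where
  "conformal_parameters A B \<epsilon> \<psi> N = {c \<in> A. (\<forall>d\<in>B. positively_compatible c d) \<and>
     (\<forall>w\<in>chart_image c. \<exists>r. r \<noteq> 0 \<and> (\<forall>u v. second_form \<epsilon> \<psi> N c w u v = r * (u \<bullet> v)))}"

text \<open>A quadratic form \<open>q dz\<^sup>2\<close> is given by its coefficient \<open>q c\<close> in each complex chart \<open>c\<close>.\<close>

definition holomorphic_quadratic_form ::
  "'a chart set \<Rightarrow> ('a chart \<Rightarrow> complex \<Rightarrow> complex) \<Rightarrow> bool" where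
  "holomorphic_quadratic_form C q \<longleftrightarrow>
     (\<forall>c\<in>C. q c holomorphic_on chart_image c) \<and>
     (\<forall>c\<in>C. \<forall>d\<in>C. transition c d holomorphic_on overlap c d \<and>
        (\<forall>w\<in>overlap c d. q c w = q d (transition c d w) * (deriv (transition c d) w)\<^sup>2))"

definition dz :: "(complex \<Rightarrow> complex) \<Rightarrow> complex \<Rightarrow> complex" where
  "dz f w = (pd 1 f w - \<i> * pd \<i> f w) / 2"

definition dz_vec :: "(complex \<Rightarrow> real ^ 4) \<Rightarrow> complex \<Rightarrow> complex ^ 4" where
  "dz_vec f w = (\<chi> k. dz (\<lambda>z. of_real (f z $ k)) w)"

definition height :: "('a \<Rightarrow> real ^ 4) \<Rightarrow> 'a \<Rightarrow> real" where
  "height \<psi> p = \<psi> p $ 4"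

end

(*
  In coordinates s + i t conformal for II, with E, F, G the coefficients of I, r = II(1, 1),
  W = E G - F^2, nu the vertical component of N and h the height, the Gauss equation reads
  (K - eps nu^2) W = r^2. Differentiating it and eliminating the derivatives of r by Codazzi's
  equation and those of nu by Weingarten's gives the tangential part of the coordinate Laplacian
  of psi: r <Lap psi, psi_u> = - 2 eps nu W h_u. Together with <Lap psi, N> = 2 r this yields
  r Lap h = 2 nu W (K - eps), so that <Lap psi, psi_u> + h_u Lap h / (eps K - 1) = 0; these are
  the Cauchy-Riemann equations of the coefficient of Q.
*)

theory Submission
  imports Defs
begin

section \<open>Partial derivatives\<close>

text \<open>The curvature in the hypotheses is intrinsic, defined through Koszul's formula, so the
  Gauss equation must itself be derived. The route goes through R^4 with its flat metric (Lorentzian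
  for \<epsilon> = -1), where the surface has two normals: \<open>N\<close> and the horizontal part
  \<open>\<eta>\<close> of the position, of square \<epsilon>. The components along
  \<open>\<eta>\<close> carry the curvature of the ambient product and produce every term with
  \<epsilon> nu. Coordinates conformal for II are in general not conformal for I. Hence E, F, G stay
  arbitrary, vectors are expanded in a non-orthogonal tangent basis, and identities are multiplied
  by W to avoid denominators. The elimination closes because the derivative of W and Codazzi's
  equation contain the same mixed second derivatives of psi; these cancel, and the pure ones combine
  to the Laplacian. Constancy of K is what removes a derivative of K from this computation. The
  constant in Q is forced: the tangential Laplacian is - \<epsilon> / (K - \<epsilon>) times h_u Lap
  h, and \<epsilon>^2 = 1 turns \<epsilon> / (K - \<epsilon>) into 1 / (\<epsilon> K - 1).\<close>

lemma pd_has_derivative: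
  assumes "f differentiable at w"
  shows "(f has_derivative (\<lambda>u. pd u f w)) (at w)"
  using assms unfolding pd_def by (simp add: frechet_derivative_works)

lemma pd_eq:
  assumes "(f has_derivative f') (at w)"
  shows "pd u f w = f' u"
  using frechet_derivative_at [OF assms] by (simp add: pd_def)

text \<open>\<open>frechet_derivative\<close> selects a map satisfying the derivative predicate, and
  functions that agree near \<open>w\<close> have the same predicate there.\<close>

lemma pd_cong_open:
  assumes "open D" "w \<in> D" "\<And>z. z \<in> D \<Longrightarrow> f z = g z"
  shows "pd u f w = pd u g w"
proof -
  have "(f has_derivative f') (at w) \<longleftrightarrow> (g has_derivative f') (at w)" for f'
    using has_derivative_transform_within_open [OF _ assms(1,2), of f f' UNIV g]
      has_derivative_transform_within_open [OF _ assms(1,2), of g f' UNIV f] assms(3)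
    by metis
  then show ?thesis by (simp add: pd_def frechet_derivative_def)
qed

lemma pd_const [simp]: "pd u (\<lambda>z. c) w = 0"
  by (simp add: pd_def)

lemma
  fixes f :: "complex \<Rightarrow> 'b::real_normed_vector"
  assumes "f differentiable at w"
  shows pd_add: "pd (u + v) f w = pd u f w + pd v f w"
    and pd_scaleR: "pd (a *\<^sub>R u) f w = a *\<^sub>R pd u f w"
  using linear_add [OF has_derivative_linear [OF pd_has_derivative [OF assms]]]
    linear_scale [OF has_derivative_linear [OF pd_has_derivative [OF assms]]]
  by simp_all

lemma pd_decompose:
  assumes "f differentiable at w"
  shows "pd u f w = Re u *\<^sub>R pd 1 f w + Im u *\<^sub>R pd \<i> f w"
proof -
  have "u = Re u *\<^sub>R 1 + Im u *\<^sub>R \<i>" by (simp add: complex_eq_iff)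
  then show ?thesis using pd_add pd_scaleR assms by metis
qed

lemma pd_bounded_linear:
  assumes "bounded_linear L" "f differentiable at w"
  shows "pd u (\<lambda>z. L (f z)) w = L (pd u f w)"
  by (rule pd_eq) (rule bounded_linear.has_derivative [OF assms(1) pd_has_derivative [OF assms(2)]])

lemma pd_bounded_bilinear:
  assumes "bounded_bilinear b" "f differentiable at w" "g differentiable at w"
  shows "pd u (\<lambda>z. b (f z) (g z)) w = b (f w) (pd u g w) + b (pd u f w) (g w)"
  by (rule pd_eq)
    (rule bounded_bilinear.FDERIV [OF assms(1) pd_has_derivative [OF assms(2)]
          pd_has_derivative [OF assms(3)]])

lemma differentiable_bounded_bilinear:
  fixes f :: "complex \<Rightarrow> 'b::real_normed_vector" and g :: "complex \<Rightarrow> 'c::real_normed_vector"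
  assumes "bounded_bilinear b" "f differentiable at w" "g differentiable at w"
  shows "(\<lambda>z. b (f z) (g z)) differentiable at w"
  using bounded_bilinear.FDERIV [OF assms(1) pd_has_derivative [OF assms(2)]
          pd_has_derivative [OF assms(3)]] by (rule differentiableI)

lemma differentiable_bounded_linear:
  fixes f :: "complex \<Rightarrow> 'b::real_normed_vector"
  assumes "bounded_linear L" "f differentiable at w"
  shows "(\<lambda>z. L (f z)) differentiable at w"
  using bounded_linear.has_derivative [OF assms(1) pd_has_derivative [OF assms(2)]]
  by (rule differentiableI)

lemmas pd_mult = pd_bounded_bilinear [OF bounded_bilinear_mult]

lemma
  assumes "f differentiable at w" "g differentiable at w"
  shows pd_plus: "pd u (\<lambda>z. f z + g z) w = pd u f w + pd u g w"
    and pd_minus: "pd u (\<lambda>z. f z - g z) w = pd u f w - pd u g w"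
  by (rule pd_eq, intro derivative_intros pd_has_derivative assms)+

lemma pd_uminus:
  assumes "f differentiable at w"
  shows "pd u (\<lambda>z. - f z) w = - pd u f w"
  by (rule pd_bounded_linear [OF bounded_linear_minus [OF bounded_linear_ident] assms])

lemma pd_chain:
  assumes "f differentiable at w" "g differentiable at (f w)"
  shows "pd u (\<lambda>z. g (f z)) w = pd (pd u f w) g (f w)"
  using pd_eq [OF diff_chain_at [OF pd_has_derivative [OF assms(1)] pd_has_derivative [OF assms(2)]]]
  by (simp add: o_def)

lemma smooth_on_pd: "smooth_on f D \<Longrightarrow> smooth_on (pd u f) D"
  using Ck_on.simps(2) unfolding smooth_on_def by blast

lemma smooth_on_differentiable:
  assumes "smooth_on f D" "open D" "w \<in> D"
  shows "f differentiable at w"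
  using assms Ck_on.simps(2) differentiable_on_eq_differentiable_at
  unfolding smooth_on_def by blast

lemma smooth_on_isCont:
  assumes "smooth_on f D" "open D" "w \<in> D"
  shows "isCont f w"
  using assms differentiable_imp_continuous_within smooth_on_differentiable by blast

section \<open>Symmetry of mixed second derivatives\<close>

lemma mvt_direction:
  fixes f :: "complex \<Rightarrow> real"
  assumes "0 < h" "\<And>x. 0 \<le> x \<Longrightarrow> x \<le> h \<Longrightarrow> f differentiable at (a + x *\<^sub>R u)"
  obtains \<xi> where "0 < \<xi>" "\<xi> < h" "f (a + h *\<^sub>R u) - f a = h * pd u f (a + \<xi> *\<^sub>R u)"
proof -
  have "((\<lambda>x. f (a + x *\<^sub>R u)) has_derivative (\<lambda>y. y * pd u f (a + x *\<^sub>R u))) (at x within {0..h})"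
    if "0 \<le> x" "x \<le> h" for x
  proof -
    have 1: "((\<lambda>x. a + x *\<^sub>R u) has_derivative (\<lambda>y. y *\<^sub>R u)) (at x within {0..h})"
      by (auto intro!: derivative_eq_intros)
    have "(f has_derivative (\<lambda>v. pd v f (a + x *\<^sub>R u))) (at (a + x *\<^sub>R u))"
      using assms(2) [OF that] by (rule pd_has_derivative)
    from has_derivative_compose [OF 1 this]
    show ?thesis using pd_scaleR [OF assms(2) [OF that]] by simp
  qed
  from mvt_simple [OF assms(1) this] show ?thesis using that by auto
qed

text \<open>Applied in both orders, this exhibits the two mixed derivatives as limits of the same second
  difference quotient.\<close>

lemma second_difference:
  fixes f :: "complex \<Rightarrow> real"
  assumes "smooth_on f D" "open D" "0 < h"
    and D: "\<And>x y. 0 \<le> x \<Longrightarrow> x \<le> h \<Longrightarrow> 0 \<le> y \<Longrightarrow> y \<le> h \<Longrightarrow> w + x *\<^sub>R u + y *\<^sub>R v \<in> D"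
  obtains x y where "0 \<le> x" "x \<le> h" "0 \<le> y" "y \<le> h"
    "f (w + h *\<^sub>R u + h *\<^sub>R v) - f (w + h *\<^sub>R u) - f (w + h *\<^sub>R v) + f w
      = h * h * pd v (pd u f) (w + x *\<^sub>R u + y *\<^sub>R v)"
proof -
  \<comment> \<open>The second difference of \<open>f\<close> is the increment of \<open>k\<close>
    along \<open>h *\<^sub>R u\<close>. One mean value step for \<open>k\<close> and one for
    \<open>pd u f\<close> produce the two derivatives.\<close>
  define k where "k z = f (z + h *\<^sub>R v) - f z" for z
  have kd: "(k has_derivative (\<lambda>d. pd d f (w + x *\<^sub>R u + h *\<^sub>R v) - pd d f (w + x *\<^sub>R u)))
    (at (w + x *\<^sub>R u))" if "0 \<le> x" "x \<le> h" for x
  proof -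
    have "w + x *\<^sub>R u + h *\<^sub>R v \<in> D" "w + x *\<^sub>R u \<in> D"
      using D [OF that, of h] D [OF that, of 0] \<open>0 < h\<close> by auto
    then have 1: "(f has_derivative (\<lambda>d. pd d f (w + x *\<^sub>R u + h *\<^sub>R v))) (at (w + x *\<^sub>R u + h *\<^sub>R v))"
      and 2: "(f has_derivative (\<lambda>d. pd d f (w + x *\<^sub>R u))) (at (w + x *\<^sub>R u))"
      using assms smooth_on_differentiable pd_has_derivative by blast+
    have "((\<lambda>z. z + h *\<^sub>R v) has_derivative (\<lambda>d. d)) (at (w + x *\<^sub>R u))"
      by (auto intro!: derivative_eq_intros)
    from has_derivative_compose [OF this 1] 2 show ?thesis
      unfolding k_def by (auto intro!: derivative_intros)
  qed
  obtain x where x: "0 < x" "x < h" "k (w + h *\<^sub>R u) - k w = h * pd u k (w + x *\<^sub>R u)"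
    by (rule mvt_direction [OF \<open>0 < h\<close>, of k w u]) (use differentiableI [OF kd] in auto)
  have "pd u f differentiable at (w + x *\<^sub>R u + y *\<^sub>R v)" if "0 \<le> y" "y \<le> h" for y
    using smooth_on_differentiable [OF smooth_on_pd [OF assms(1)] assms(2)] D [of x y] x that by auto
  then obtain y where y: "0 < y" "y < h"
    "pd u f (w + x *\<^sub>R u + h *\<^sub>R v) - pd u f (w + x *\<^sub>R u) = h * pd v (pd u f) (w + x *\<^sub>R u + y *\<^sub>R v)"
    by (rule mvt_direction [OF \<open>0 < h\<close>, of "pd u f" "w + x *\<^sub>R u" v]) auto
  have "pd u k (w + x *\<^sub>R u) = h * pd v (pd u f) (w + x *\<^sub>R u + y *\<^sub>R v)"
    using pd_eq [OF kd, of x u] x y by simp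
  then show ?thesis
    using that [of x y] x y by (simp add: k_def)
qed

text \<open>The same second difference equals \<open>h * h\<close> times either mixed derivative,
  each at its own nearby point; continuity of both at \<open>w\<close> then rules out a gap.\<close>

lemma pd_commute_real:
  fixes f :: "complex \<Rightarrow> real"
  assumes "smooth_on f D" "open D" "w \<in> D"
  shows "pd u (pd v f) w = pd v (pd u f) w"
proof (rule ccontr)
  \<comment> \<open>Half the gap: two numbers within \<open>e\<close> of the respective values at
    \<open>w\<close> cannot be equal.\<close>
  define e where "e = \<bar>pd u (pd v f) w - pd v (pd u f) w\<bar> / 2"
  assume "pd u (pd v f) w \<noteq> pd v (pd u f) w"
  then have "e > 0" by (simp add: e_def)
  have near: "\<exists>\<delta>>0. \<forall>z. dist z w < \<delta> \<longrightarrow> dist (pd a (pd b f) z) (pd a (pd b f) w) < e" for a b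
    using smooth_on_isCont [OF smooth_on_pd [OF smooth_on_pd [OF assms(1)]] assms(2,3)] \<open>e > 0\<close>
    unfolding continuous_at_eps_delta by blast
  obtain d1 where d1: "d1 > 0" "\<And>z. dist z w < d1 \<Longrightarrow> \<bar>pd u (pd v f) z - pd u (pd v f) w\<bar> < e"
    using near [of u v] by (auto simp: dist_real_def)
  obtain d2 where d2: "d2 > 0" "\<And>z. dist z w < d2 \<Longrightarrow> \<bar>pd v (pd u f) z - pd v (pd u f) w\<bar> < e"
    using near [of v u] by (auto simp: dist_real_def)
  obtain d3 where d3: "d3 > 0" "ball w d3 \<subseteq> D"
    using assms(2,3) openE by blast
  define d where "d = min d1 (min d2 d3)"
  \<comment> \<open>The summand 1 keeps the denominator positive even for \<open>u = v = 0\<close>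
    and puts the whole parallelogram strictly inside the ball of radius \<open>d\<close>.\<close>
  define h where "h = d / (norm u + norm v + 1)"
  have pos: "norm u + norm v + 1 > 0" by (simp add: add_nonneg_pos)
  have "d > 0" using d1 d2 d3 by (simp add: d_def)
  then have "h > 0" using pos by (simp add: h_def)
  have small: "dist (w + x *\<^sub>R u + y *\<^sub>R v) w < d" if "0 \<le> x" "x \<le> h" "0 \<le> y" "y \<le> h" for x y
  proof -
    have "dist (w + x *\<^sub>R u + y *\<^sub>R v) w \<le> x * norm u + y * norm v"
      using norm_triangle_ineq [of "x *\<^sub>R u" "y *\<^sub>R v"] that by (simp add: dist_norm add.assoc)
    also have "\<dots> \<le> h * norm u + h * norm v"
      using that by (intro add_mono mult_right_mono) auto
    also have "\<dots> < h * (norm u + norm v + 1)"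
      using \<open>h > 0\<close> by (simp add: algebra_simps)
    also have "\<dots> = d" using pos by (simp add: h_def)
    finally show ?thesis .
  qed
  have inD: "w + x *\<^sub>R u + y *\<^sub>R v \<in> D" if "0 \<le> x" "x \<le> h" "0 \<le> y" "y \<le> h" for x y
    using small [OF that] d3 by (auto simp: d_def dist_commute)
  obtain x y where xy: "0 \<le> x" "x \<le> h" "0 \<le> y" "y \<le> h"
    "f (w + h *\<^sub>R u + h *\<^sub>R v) - f (w + h *\<^sub>R u) - f (w + h *\<^sub>R v) + f w
      = h * h * pd v (pd u f) (w + x *\<^sub>R u + y *\<^sub>R v)"
    by (rule second_difference [OF assms(1,2) \<open>h > 0\<close>, of w u v]) (use inD in auto)
  have inD': "w + x *\<^sub>R v + y *\<^sub>R u \<in> D" if "0 \<le> x" "x \<le> h" "0 \<le> y" "y \<le> h" for x y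
    using inD [of y x] that by (simp add: add_ac)
  obtain x' y' where xy': "0 \<le> x'" "x' \<le> h" "0 \<le> y'" "y' \<le> h"
    "f (w + h *\<^sub>R v + h *\<^sub>R u) - f (w + h *\<^sub>R v) - f (w + h *\<^sub>R u) + f w
      = h * h * pd u (pd v f) (w + x' *\<^sub>R v + y' *\<^sub>R u)"
    by (rule second_difference [OF assms(1,2) \<open>h > 0\<close>, of w v u]) (use inD' in auto)
  have "h * h * pd v (pd u f) (w + x *\<^sub>R u + y *\<^sub>R v) = h * h * pd u (pd v f) (w + x' *\<^sub>R v + y' *\<^sub>R u)"
    using xy(5) xy'(5) by (simp add: algebra_simps)
  then have eq: "pd v (pd u f) (w + x *\<^sub>R u + y *\<^sub>R v) = pd u (pd v f) (w + y' *\<^sub>R u + x' *\<^sub>R v)"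
    using \<open>h > 0\<close> by (simp add: add_ac)
  have "dist (w + x *\<^sub>R u + y *\<^sub>R v) w < d2" "dist (w + y' *\<^sub>R u + x' *\<^sub>R v) w < d1"
    using small [of x y] small [of y' x'] xy xy' by (auto simp: d_def)
  from d2(2) [OF this(1)] d1(2) [OF this(2)]
  have "\<bar>pd u (pd v f) w - pd v (pd u f) w\<bar> < e + e"
    unfolding eq by linarith
  then show False by (simp add: e_def)
qed

lemma smooth_on_inner_left:
  fixes f :: "complex \<Rightarrow> 'b::real_inner"
  assumes "smooth_on f D" "open D"
  shows "smooth_on (\<lambda>z. f z \<bullet> b) D"
proof -
  \<comment> \<open>The derivative of the inner product has its expected form only on
    \<open>D\<close>, whereas \<open>Ck_on\<close> speaks of functions on the whole plane; this
    transfer bridges the difference.\<close>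
  have cong: "Ck_on k f D \<Longrightarrow> (\<And>z. z \<in> D \<Longrightarrow> f z = g z) \<Longrightarrow> Ck_on k g D"
    for k and f g :: "complex \<Rightarrow> real"
  proof (induction k arbitrary: f g)
    case 0
    then show ?case by simp
  next
    case (Suc k)
    then have "g differentiable_on D"
      unfolding Ck_on.simps differentiable_on_def differentiable_def
      by (metis has_derivative_transform)
    moreover have "Ck_on k (pd u g) D" for u
      using Suc.IH [of "pd u f"] Suc.prems pd_cong_open [OF assms(2), of _ f g]
      by auto
    ultimately show ?case by simp
  qed
  have "Ck_on k f D \<Longrightarrow> Ck_on k (\<lambda>z. f z \<bullet> b) D" for k and f :: "complex \<Rightarrow> 'b"
  proof (induction k arbitrary: f)
    case 0
    then show ?case by (auto intro: continuous_intros)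
  next
    case (Suc k)
    then have diff: "f differentiable at z" if "z \<in> D" for z
      using that assms(2) by (simp add: differentiable_on_eq_differentiable_at)
    have "(\<lambda>z. f z \<bullet> b) differentiable_on D"
      using differentiable_bounded_linear [OF bounded_linear_inner_left diff] assms(2)
      by (simp add: differentiable_on_eq_differentiable_at)
    moreover have "Ck_on k (pd u (\<lambda>z. f z \<bullet> b)) D" for u
      using cong [OF Suc.IH [of "pd u f"]] Suc.prems
        pd_bounded_linear [OF bounded_linear_inner_left diff] by simp
    ultimately show ?case by simp
  qed
  then show ?thesis using assms(1) by (simp add: smooth_on_def)
qed

text \<open>Inner products with a fixed vector reduce this to real functions; testing with the
  difference of the two sides makes its square vanish.\<close>

lemma pd_commute:
  fixes f :: "complex \<Rightarrow> 'b::real_inner"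
  assumes "smooth_on f D" "open D" "w \<in> D"
  shows "pd u (pd v f) w = pd v (pd u f) w"
proof -
  have inner: "pd u (pd v (\<lambda>z. f z \<bullet> b)) w = pd u (pd v f) w \<bullet> b" for u v b
  proof -
    have "pd u (pd v (\<lambda>z. f z \<bullet> b)) w = pd u (\<lambda>z. pd v f z \<bullet> b) w"
      using assms smooth_on_differentiable
      by (intro pd_cong_open [of D] pd_bounded_linear bounded_linear_inner_left) blast+
    also have "\<dots> = pd u (pd v f) w \<bullet> b"
      using assms smooth_on_differentiable smooth_on_pd
      by (intro pd_bounded_linear bounded_linear_inner_left) blast
    finally show ?thesis .
  qed
  have "pd u (pd v f) w \<bullet> b = pd v (pd u f) w \<bullet> b" for b
    using pd_commute_real [OF smooth_on_inner_left [OF assms(1,2)] assms(2,3), of u v b] inner by simp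
  then have "(pd u (pd v f) w - pd v (pd u f) w) \<bullet> (pd u (pd v f) w - pd v (pd u f) w) = 0"
    by (simp add: inner_diff_left)
  then show ?thesis by simp
qed

section \<open>The ambient bilinear form\<close>

lemma form_commute: "form \<epsilon> x y = form \<epsilon> y x" for x y :: "real ^ 4"
  by (simp add: form_def)

lemma bounded_bilinear_form: "bounded_bilinear (form \<epsilon> :: real ^ 4 \<Rightarrow> real ^ 4 \<Rightarrow> real)"
proof -
  \<comment> \<open>The form is the Euclidean inner product after scaling the first coordinate of
    the second argument by \<epsilon>.\<close>
  have "form \<epsilon> = (\<lambda>x y :: real ^ 4. x \<bullet> (y + (\<epsilon> - 1) *\<^sub>R (y $ 1 *\<^sub>R axis 1 1)))"
    by (intro ext) (simp add: form_def inner_vec_def sum_4 axis_def algebra_simps)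
  moreover have "bounded_linear (\<lambda>y :: real ^ 4. y + (\<epsilon> - 1) *\<^sub>R (y $ 1 *\<^sub>R axis 1 1))"
    by (intro bounded_linear_intros bounded_linear_vec_nth)
  ultimately show ?thesis
    using bounded_bilinear.comp [OF bounded_bilinear_inner bounded_linear_ident] by simp
qed

lemmas form_bilinear_simps =
  bounded_bilinear.add_left [OF bounded_bilinear_form]
  bounded_bilinear.add_right [OF bounded_bilinear_form]
  bounded_bilinear.diff_left [OF bounded_bilinear_form]
  bounded_bilinear.diff_right [OF bounded_bilinear_form]
  bounded_bilinear.minus_left [OF bounded_bilinear_form]
  bounded_bilinear.minus_right [OF bounded_bilinear_form]
  bounded_bilinear.scaleR_left [OF bounded_bilinear_form]
  bounded_bilinear.scaleR_right [OF bounded_bilinear_form]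
  bounded_bilinear.zero_left [OF bounded_bilinear_form]
  bounded_bilinear.zero_right [OF bounded_bilinear_form]

lemma pd_form:
  fixes f g :: "complex \<Rightarrow> real ^ 4"
  assumes "f differentiable at w" "g differentiable at w"
  shows "pd u (\<lambda>z. form \<epsilon> (f z) (g z)) w = form \<epsilon> (pd u f w) (g w) + form \<epsilon> (f w) (pd u g w)"
  using pd_bounded_bilinear [OF bounded_bilinear_form assms] by (simp add: add.commute)

lemmas differentiable_form = differentiable_bounded_bilinear [OF bounded_bilinear_form]

text \<open>At a point \<open>x\<close> of the ambient product, \<open>horizontal x\<close> is the normal vector of the product
  in \<open>\<real>\<^sup>4\<close>.\<close>

definition horizontal :: "real ^ 4 \<Rightarrow> real ^ 4" where
  "horizontal x = x - x $ 4 *\<^sub>R axis 4 1"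

lemma bounded_linear_horizontal: "bounded_linear horizontal"
  unfolding horizontal_def by (intro bounded_linear_intros bounded_linear_vec_nth)

lemma form_vertical: "form \<epsilon> x (axis 4 1) = x $ 4" for x :: "real ^ 4"
  by (simp add: form_def axis_def)

lemma form_horizontal: "form \<epsilon> x (horizontal y) = form \<epsilon> x y - x $ 4 * y $ 4"
  unfolding horizontal_def by (simp add: form_bilinear_simps form_vertical)

lemma ambient_form_horizontal: "x \<in> ambient \<epsilon> \<Longrightarrow> form \<epsilon> (horizontal x) (horizontal x) = \<epsilon>"
  by (simp add: ambient_def form_def horizontal_def axis_def power2_eq_square algebra_simps)

lemma tangent_ambient_iff: "v \<in> tangent_ambient \<epsilon> x \<longleftrightarrow> form \<epsilon> v (horizontal x) = 0"
  by (simp add: tangent_ambient_def form_def horizontal_def axis_def algebra_simps)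

text \<open>For \<epsilon> = -1 the form is indefinite on R^4, but tangent vectors of the
  hyperboloid are spacelike: Cauchy-Schwarz bounds (x_1 a)^2 = (x_2 b + x_3 c)^2 by (x_1^2 - 1)(b^2
  + c^2).\<close>

lemma tangent_ambient_positive:
  assumes "\<epsilon> \<in> {1, -1}" "x \<in> ambient \<epsilon>" "v \<in> tangent_ambient \<epsilon> x" "v \<noteq> 0"
  shows "form \<epsilon> v v > 0"
proof -
  have nz: "v $ 1 \<noteq> 0 \<or> v $ 2 \<noteq> 0 \<or> v $ 3 \<noteq> 0 \<or> v $ 4 \<noteq> 0"
    using \<open>v \<noteq> 0\<close> by (simp add: vec_eq_iff forall_4)
  consider "\<epsilon> = 1" | "\<epsilon> = -1" using assms(1) by blast
  then show ?thesis
  proof cases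
    case 1
    have "v $ 1 * v $ 1 + v $ 2 * v $ 2 + v $ 3 * v $ 3 + v $ 4 * v $ 4 > 0"
      using nz by (smt (verit) mult_eq_0_iff zero_le_square)
    then show ?thesis using 1 by (simp add: form_def)
  next
    case 2
    define a b c d where "a = v $ 1" "b = v $ 2" "c = v $ 3" "d = v $ 4"
    note v = this
    have x: "(x $ 1)\<^sup>2 = (x $ 2)\<^sup>2 + (x $ 3)\<^sup>2 + 1" "x $ 1 * a = x $ 2 * b + x $ 3 * c"
      using assms(2,3) 2 by (auto simp: ambient_def tangent_ambient_def v)
    have "(x $ 1)\<^sup>2 * a\<^sup>2 = (x $ 2 * b + x $ 3 * c)\<^sup>2"
      using x(2) by (metis power_mult_distrib)
    also have "\<dots> = ((x $ 2)\<^sup>2 + (x $ 3)\<^sup>2) * (b\<^sup>2 + c\<^sup>2) - (x $ 2 * c - x $ 3 * b)\<^sup>2"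
      by (simp add: power2_eq_square algebra_simps)
    also have "\<dots> \<le> ((x $ 1)\<^sup>2 - 1) * (b\<^sup>2 + c\<^sup>2)"
      using x(1) by simp
    finally have "b\<^sup>2 + c\<^sup>2 \<le> (x $ 1)\<^sup>2 * (b\<^sup>2 + c\<^sup>2 - a\<^sup>2)"
      by (simp add: algebra_simps)
    moreover have x1: "(x $ 1)\<^sup>2 > 0" using x(1) by (smt (verit) zero_le_power2)
    ultimately have le: "(b\<^sup>2 + c\<^sup>2) / (x $ 1)\<^sup>2 \<le> b\<^sup>2 + c\<^sup>2 - a\<^sup>2"
      by (simp add: pos_divide_le_eq mult.commute)
    have "b\<^sup>2 + c\<^sup>2 > 0 \<or> b = 0 \<and> c = 0" by (simp add: sum_power2_gt_zero_iff)
    then have "b\<^sup>2 + c\<^sup>2 - a\<^sup>2 + d\<^sup>2 > 0"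
    proof
      assume "b\<^sup>2 + c\<^sup>2 > 0"
      then have "(b\<^sup>2 + c\<^sup>2) / (x $ 1)\<^sup>2 > 0" using x1 by simp
      then show ?thesis using le by (smt (verit) zero_le_power2)
    next
      assume bc: "b = 0 \<and> c = 0"
      then have "a = 0" using x x1 by auto
      then have "d \<noteq> 0" using bc nz v by auto
      then show ?thesis using bc \<open>a = 0\<close> by simp
    qed
    then show ?thesis using 2 by (simp add: form_def v power2_eq_square)
  qed
qed

text \<open>Parseval's identity for the frame \<open>p, q, n, e\<close>, cleared of the denominator
  \<open>\<langle>p, p\<rangle> \<langle>q, q\<rangle> - \<langle>p, q\<rangle>\<^sup>2\<close>.\<close>

lemma form_frame:
  fixes p q n e v v' :: "real ^ 4"
  assumes \<epsilon>: "\<epsilon> * \<epsilon> = 1"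
    and orth: "form \<epsilon> p n = 0" "form \<epsilon> q n = 0" "form \<epsilon> p e = 0" "form \<epsilon> q e = 0" "form \<epsilon> n e = 0"
    and unit: "form \<epsilon> n n = 1" "form \<epsilon> e e = \<epsilon>"
    and W: "W = form \<epsilon> p p * form \<epsilon> q q - (form \<epsilon> p q)\<^sup>2" "W \<noteq> 0"
  shows "W * form \<epsilon> v v' =
    form \<epsilon> q q * form \<epsilon> v p * form \<epsilon> v' p
    - form \<epsilon> p q * (form \<epsilon> v p * form \<epsilon> v' q + form \<epsilon> v q * form \<epsilon> v' p)
    + form \<epsilon> p p * form \<epsilon> v q * form \<epsilon> v' q
    + W * (form \<epsilon> v n * form \<epsilon> v' n + \<epsilon> * form \<epsilon> v e * form \<epsilon> v' e)"
proof -
  \<comment> \<open>The frame spans R^4: its Gram relations make the kernel of \<open>L\<close>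
    trivial, and an injective endomorphism of R^4 is onto. The identity then only has to be checked
    on combinations of the frame.\<close>
  define L where "L x = x $ 1 *\<^sub>R p + x $ 2 *\<^sub>R q + x $ 3 *\<^sub>R n + x $ 4 *\<^sub>R e" for x :: "real ^ 4"
  have lin: "linear L"
    unfolding L_def by (intro linearI) (simp_all add: algebra_simps)
  have orth': "form \<epsilon> n p = 0" "form \<epsilon> n q = 0" "form \<epsilon> e p = 0" "form \<epsilon> e q = 0" "form \<epsilon> e n = 0"
    using orth form_commute by metis+
  have Lp: "form \<epsilon> (L x) p = x $ 1 * form \<epsilon> p p + x $ 2 * form \<epsilon> p q"
    and Lq: "form \<epsilon> (L x) q = x $ 1 * form \<epsilon> p q + x $ 2 * form \<epsilon> q q"
    and Ln: "form \<epsilon> (L x) n = x $ 3"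
    and Le: "form \<epsilon> (L x) e = x $ 4 * \<epsilon>" for x
    unfolding L_def using orth orth' unit form_commute [of \<epsilon> q p]
    by (simp_all add: form_bilinear_simps)
  have "x = 0" if "L x = 0" for x
  proof -
    have z: "x $ 1 * form \<epsilon> p p + x $ 2 * form \<epsilon> p q = 0" "x $ 1 * form \<epsilon> p q + x $ 2 * form \<epsilon> q q = 0"
      "x $ 3 = 0" "x $ 4 * \<epsilon> = 0"
      using Lp [of x] Lq [of x] Ln [of x] Le [of x] that by (simp_all add: form_bilinear_simps)
    have "x $ 1 * W = (x $ 1 * form \<epsilon> p p + x $ 2 * form \<epsilon> p q) * form \<epsilon> q q
        - (x $ 1 * form \<epsilon> p q + x $ 2 * form \<epsilon> q q) * form \<epsilon> p q"
      "x $ 2 * W = (x $ 1 * form \<epsilon> p q + x $ 2 * form \<epsilon> q q) * form \<epsilon> p p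
        - (x $ 1 * form \<epsilon> p p + x $ 2 * form \<epsilon> p q) * form \<epsilon> p q"
      unfolding W(1) by (simp_all add: power2_eq_square algebra_simps)
    then have "x $ 1 * W = 0" "x $ 2 * W = 0" unfolding z by simp_all
    then have "x $ 1 = 0" "x $ 2 = 0" using W(2) by simp_all
    moreover have "x $ 4 = 0" using z(4) \<epsilon> by auto
    ultimately show ?thesis using z(3) by (simp add: vec_eq_iff forall_4)
  qed
  then have "inj L" using lin by (simp add: linear_injective_0)
  then have "surj L" using lin linear_injective_imp_surjective by blast
  then obtain x y where xy: "v = L x" "v' = L y" by (metis surjD)
  have "form \<epsilon> (L x) (L y) = y $ 1 * form \<epsilon> (L x) p + y $ 2 * form \<epsilon> (L x) q
      + y $ 3 * form \<epsilon> (L x) n + y $ 4 * form \<epsilon> (L x) e"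
    unfolding L_def [of y] by (simp add: form_bilinear_simps)
  then have "W * form \<epsilon> (L x) (L y) =
    form \<epsilon> q q * form \<epsilon> (L x) p * form \<epsilon> (L y) p
    - form \<epsilon> p q * (form \<epsilon> (L x) p * form \<epsilon> (L y) q + form \<epsilon> (L x) q * form \<epsilon> (L y) p)
    + form \<epsilon> p p * form \<epsilon> (L x) q * form \<epsilon> (L y) q
    + W * (form \<epsilon> (L x) n * form \<epsilon> (L y) n + (\<epsilon> * \<epsilon>) * \<epsilon> * x $ 4 * y $ 4)"
    unfolding Lp Lq Ln Le W(1) \<epsilon> by (simp add: power2_eq_square algebra_simps)
  then show ?thesis unfolding xy Le by (simp add: mult_ac)
qed

section \<open>Immersions of a coordinate domain\<close>

text \<open>The data read in a single chart image; the surface and its atlas are forgotten until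
  charts are compared.\<close>

locale local_immersion =
  fixes D :: "complex set" and \<Psi> N :: "complex \<Rightarrow> real ^ 4" and \<epsilon> :: real
  assumes eps: "\<epsilon> \<in> {1, -1}"
    and open_D: "open D"
    and smooth_\<Psi>: "smooth_on \<Psi> D"
    and smooth_N: "smooth_on N D"
    and in_ambient: "w \<in> D \<Longrightarrow> \<Psi> w \<in> ambient \<epsilon>"
    and immersed: "w \<in> D \<Longrightarrow> inj (\<lambda>u. pd u \<Psi> w)"
    and N_tangent: "w \<in> D \<Longrightarrow> N w \<in> tangent_ambient \<epsilon> (\<Psi> w)"
    and N_unit: "w \<in> D \<Longrightarrow> form \<epsilon> (N w) (N w) = 1"
    and N_normal: "w \<in> D \<Longrightarrow> form \<epsilon> (pd u \<Psi> w) (N w) = 0"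
begin

abbreviation \<eta> :: "complex \<Rightarrow> real ^ 4" where
  "\<eta> w \<equiv> horizontal (\<Psi> w)"

definition g :: "complex \<Rightarrow> complex \<Rightarrow> complex \<Rightarrow> real" where
  "g w u v = form \<epsilon> (pd u \<Psi> w) (pd v \<Psi> w)"

definition W :: "complex \<Rightarrow> real" where
  "W w = g w 1 1 * g w \<i> \<i> - (g w 1 \<i>)\<^sup>2"

lemma eps_square: "\<epsilon> * \<epsilon> = 1"
  using eps by auto

lemma \<Psi>_diff: "w \<in> D \<Longrightarrow> \<Psi> differentiable at w"
  and N_diff: "w \<in> D \<Longrightarrow> N differentiable at w"
  and pd_\<Psi>_diff: "w \<in> D \<Longrightarrow> pd u \<Psi> differentiable at w"
  and pd_N_diff: "w \<in> D \<Longrightarrow> pd u N differentiable at w"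
  and pd_pd_\<Psi>_diff: "w \<in> D \<Longrightarrow> pd u (pd v \<Psi>) differentiable at w"
  by (intro smooth_on_differentiable [OF _ open_D] smooth_on_pd smooth_\<Psi> smooth_N, assumption)+

lemma pd_\<eta>: "w \<in> D \<Longrightarrow> pd u \<eta> w = horizontal (pd u \<Psi> w)"
  and \<eta>_diff: "w \<in> D \<Longrightarrow> \<eta> differentiable at w"
  by (rule pd_bounded_linear [OF bounded_linear_horizontal \<Psi>_diff], assumption)
    (rule differentiable_bounded_linear [OF bounded_linear_horizontal \<Psi>_diff], assumption)

lemma \<Psi>_commute: "w \<in> D \<Longrightarrow> pd u (pd v \<Psi>) w = pd v (pd u \<Psi>) w"
  and N_commute: "w \<in> D \<Longrightarrow> pd u (pd v N) w = pd v (pd u N) w"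
  using pd_commute [OF smooth_\<Psi> open_D] pd_commute [OF smooth_N open_D] by simp_all

text \<open>The relations between the derivatives of \<open>\<Psi>\<close>, \<open>N\<close> and
  \<open>\<eta>\<close> below arise by differentiating inner products that are constant on
  \<open>D\<close>.\<close>

lemma pd_zero_on:
  assumes "w \<in> D" "\<And>z. z \<in> D \<Longrightarrow> f z = c"
  shows "pd u f w = 0"
  using pd_cong_open [OF open_D assms(1), of f "\<lambda>z. c"] assms(2) by simp

lemma g_commute: "g w u v = g w v u"
  unfolding g_def by (rule form_commute)

lemma pd_\<Psi>_\<eta>:
  assumes w: "w \<in> D"
  shows "form \<epsilon> (pd u \<Psi> w) (\<eta> w) = 0"
proof -
  have "pd u (\<lambda>z. form \<epsilon> (\<eta> z) (\<eta> z)) w = 0"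
    by (rule pd_zero_on [OF w]) (rule ambient_form_horizontal [OF in_ambient])
  then have "form \<epsilon> (\<eta> w) (horizontal (pd u \<Psi> w)) = 0"
    using pd_form [OF \<eta>_diff [OF w] \<eta>_diff [OF w], of u \<epsilon>] form_commute [of \<epsilon> "\<eta> w" "pd u \<eta> w"]
    by (simp add: pd_\<eta> [OF w])
  then show ?thesis
    by (simp add: form_def horizontal_def axis_def mult.commute mult.left_commute)
qed

text \<open>This is the second fundamental form of the ambient product in R^4 with respect to
  \<open>\<eta>\<close>: minus the horizontal part of the metric.\<close>

lemma pd_pd_\<Psi>_\<eta>:
  assumes w: "w \<in> D"
  shows "form \<epsilon> (pd u (pd v \<Psi>) w) (\<eta> w) = pd u \<Psi> w $ 4 * pd v \<Psi> w $ 4 - g w u v"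
proof -
  have "pd u (\<lambda>z. form \<epsilon> (pd v \<Psi> z) (\<eta> z)) w = 0"
    by (rule pd_zero_on [OF w]) (rule pd_\<Psi>_\<eta>)
  then show ?thesis
    using pd_form [OF pd_\<Psi>_diff [OF w, of v] \<eta>_diff [OF w], of u \<epsilon>] w
    by (simp add: pd_\<eta> form_horizontal g_def form_commute [of \<epsilon> "pd u \<Psi> w" "pd v \<Psi> w"] mult.commute)
qed

lemma pd_pd_\<Psi>_N:
  assumes w: "w \<in> D"
  shows "form \<epsilon> (pd u (pd v \<Psi>) w) (N w) = - form \<epsilon> (pd u N w) (pd v \<Psi> w)"
proof -
  have "pd u (\<lambda>z. form \<epsilon> (pd v \<Psi> z) (N z)) w = 0"
    by (rule pd_zero_on [OF w]) (rule N_normal)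
  then show ?thesis
    using pd_form [OF pd_\<Psi>_diff [OF w, of v] N_diff [OF w], of u \<epsilon>]
    by (simp add: form_commute [of \<epsilon> "pd u N w" "pd v \<Psi> w"])
qed

lemma N_\<eta>: "w \<in> D \<Longrightarrow> form \<epsilon> (N w) (\<eta> w) = 0"
  using N_tangent by (simp add: tangent_ambient_iff)

text \<open>Although \<open>N\<close> is tangent to the ambient product, its derivative in R^4 is
  not. Through this component the ambient curvature later enters Codazzi's equation.\<close>

lemma pd_N_\<eta>:
  assumes w: "w \<in> D"
  shows "form \<epsilon> (pd u N w) (\<eta> w) = N w $ 4 * pd u \<Psi> w $ 4"
proof -
  have "pd u (\<lambda>z. form \<epsilon> (N z) (\<eta> z)) w = 0"
    by (rule pd_zero_on [OF w]) (rule N_\<eta>)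
  then show ?thesis
    using pd_form [OF N_diff [OF w] \<eta>_diff [OF w], of u \<epsilon>] w
    by (simp add: pd_\<eta> form_horizontal N_normal form_commute [of \<epsilon> "N w" "pd u \<Psi> w"])
qed

lemma pd_N_N:
  assumes w: "w \<in> D"
  shows "form \<epsilon> (pd u N w) (N w) = 0"
proof -
  have "pd u (\<lambda>z. form \<epsilon> (N z) (N z)) w = 0"
    by (rule pd_zero_on [OF w]) (rule N_unit)
  then show ?thesis
    using pd_form [OF N_diff [OF w] N_diff [OF w], of u \<epsilon>] by (simp add: form_commute [of \<epsilon> "N w" "pd u N w"])
qed

section \<open>Positivity of the induced metric and expansion in the moving frame\<close>

lemma pd_\<Psi>_decompose: "w \<in> D \<Longrightarrow> pd u \<Psi> w = Re u *\<^sub>R pd 1 \<Psi> w + Im u *\<^sub>R pd \<i> \<Psi> w"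
  by (rule pd_decompose [OF \<Psi>_diff])

lemma g_decompose: "w \<in> D \<Longrightarrow> g w u v = Re u * g w 1 v + Im u * g w \<i> v"
  unfolding g_def by (subst pd_\<Psi>_decompose) (simp_all add: form_bilinear_simps)

lemma g_positive:
  assumes w: "w \<in> D" and "u \<noteq> 0"
  shows "g w u u > 0"
proof -
  have "pd 0 \<Psi> w = 0" using pd_\<Psi>_decompose [OF w, of 0] by simp
  then have "pd u \<Psi> w \<noteq> 0" using immersed [OF w] assms(2) injD by fastforce
  then show ?thesis
    unfolding g_def using tangent_ambient_positive [OF eps in_ambient [OF w]] pd_\<Psi>_\<eta> [OF w]
    by (simp add: tangent_ambient_iff)
qed

lemma W_positive:
  assumes w: "w \<in> D"
  shows "W w > 0"
proof -
  \<comment> \<open>With E, F, G the coefficients of \<open>g\<close>, this is G - \<i> F,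
    orthogonal to \<i> for \<open>g\<close>. Its square is G W, so W inherits positivity from
    \<open>g\<close>.\<close>
  define u where "u = Complex (g w \<i> \<i>) (- g w 1 \<i>)"
  have G: "g w \<i> \<i> > 0" using g_positive [OF w] by simp
  then have "u \<noteq> 0" by (simp add: u_def complex_eq_iff)
  have "g w u 1 = W w" "g w u \<i> = 0"
    using g_decompose [OF w, of u 1] g_decompose [OF w, of u \<i>] g_commute [of w \<i> 1]
    by (simp_all add: W_def u_def power2_eq_square mult.commute)
  then have "g w u u = g w \<i> \<i> * W w"
    using g_decompose [OF w, of u u] g_commute [of w 1 u] g_commute [of w \<i> u] by (simp add: u_def)
  then show ?thesis using g_positive [OF w \<open>u \<noteq> 0\<close>] G by (simp add: zero_less_mult_iff)
qed

lemma frame: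
  assumes w: "w \<in> D"
  shows "W w * form \<epsilon> v v' =
    g w \<i> \<i> * form \<epsilon> v (pd 1 \<Psi> w) * form \<epsilon> v' (pd 1 \<Psi> w)
    - g w 1 \<i> * (form \<epsilon> v (pd 1 \<Psi> w) * form \<epsilon> v' (pd \<i> \<Psi> w) + form \<epsilon> v (pd \<i> \<Psi> w) * form \<epsilon> v' (pd 1 \<Psi> w))
    + g w 1 1 * form \<epsilon> v (pd \<i> \<Psi> w) * form \<epsilon> v' (pd \<i> \<Psi> w)
    + W w * (form \<epsilon> v (N w) * form \<epsilon> v' (N w) + \<epsilon> * form \<epsilon> v (\<eta> w) * form \<epsilon> v' (\<eta> w))"
  unfolding g_def
proof (rule form_frame [OF eps_square])
  show "W w \<noteq> 0" using W_positive [OF w] by simp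
qed (use w in \<open>simp_all add: W_def g_def N_normal pd_\<Psi>_\<eta> N_\<eta> N_unit ambient_form_horizontal in_ambient\<close>)

text \<open>The frame expansion of the square of the unit vertical vector, which has no
  \<open>\<eta>\<close> component. Divided by \<open>W w\<close>, it says that the gradient of the
  height has square 1 - nu^2.\<close>

lemma vertical_norm:
  assumes w: "w \<in> D"
  shows "W w * (1 - (N w $ 4)\<^sup>2) = g w \<i> \<i> * (pd 1 \<Psi> w $ 4)\<^sup>2
    - 2 * g w 1 \<i> * pd 1 \<Psi> w $ 4 * pd \<i> \<Psi> w $ 4 + g w 1 1 * (pd \<i> \<Psi> w $ 4)\<^sup>2"
proof -
  have *: "form \<epsilon> (axis 4 1) x = x $ 4" for x :: "real ^ 4"
    using form_vertical form_commute by metis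
  have "\<eta> w $ 4 = 0" by (simp add: horizontal_def)
  then show ?thesis
    using frame [OF w, of "axis 4 1" "axis 4 1"] unfolding *
    by (simp add: power2_eq_square algebra_simps)
qed

subsection \<open>The Gauss equation\<close>

text \<open>The coordinates, by Cramer's rule, of the tangential part of
  \<open>pd u (pd v \<Psi>) w\<close> in the basis of coordinate vectors: the Levi-Civita connection
  obtained by projection.\<close>

definition conn :: "complex \<Rightarrow> complex \<Rightarrow> complex \<Rightarrow> complex" where
  "conn u v w = Complex
     ((g w \<i> \<i> * form \<epsilon> (pd u (pd v \<Psi>) w) (pd 1 \<Psi> w) - g w 1 \<i> * form \<epsilon> (pd u (pd v \<Psi>) w) (pd \<i> \<Psi> w)) / W w)
     ((g w 1 1 * form \<epsilon> (pd u (pd v \<Psi>) w) (pd \<i> \<Psi> w) - g w 1 \<i> * form \<epsilon> (pd u (pd v \<Psi>) w) (pd 1 \<Psi> w)) / W w)"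

lemma g_conn:
  assumes w: "w \<in> D"
  shows "g w (conn u v w) x = form \<epsilon> (pd u (pd v \<Psi>) w) (pd x \<Psi> w)"
proof -
  have W: "W w \<noteq> 0" using W_positive [OF w] by simp
  have cramer: "(g w \<i> \<i> * a - g w 1 \<i> * b) / W w * g w 1 1 + (g w 1 1 * b - g w 1 \<i> * a) / W w * g w 1 \<i> = a"
    "(g w \<i> \<i> * a - g w 1 \<i> * b) / W w * g w 1 \<i> + (g w 1 1 * b - g w 1 \<i> * a) / W w * g w \<i> \<i> = b" for a b
  proof -
    have "(g w \<i> \<i> * a - g w 1 \<i> * b) * g w 1 1 + (g w 1 1 * b - g w 1 \<i> * a) * g w 1 \<i> = a * W w"
      "(g w \<i> \<i> * a - g w 1 \<i> * b) * g w 1 \<i> + (g w 1 1 * b - g w 1 \<i> * a) * g w \<i> \<i> = b * W w"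
      by (simp_all add: W_def power2_eq_square algebra_simps)
    then show "(g w \<i> \<i> * a - g w 1 \<i> * b) / W w * g w 1 1 + (g w 1 1 * b - g w 1 \<i> * a) / W w * g w 1 \<i> = a"
      "(g w \<i> \<i> * a - g w 1 \<i> * b) / W w * g w 1 \<i> + (g w 1 1 * b - g w 1 \<i> * a) / W w * g w \<i> \<i> = b"
      using W by (simp_all add: add_divide_distrib [symmetric])
  qed
  have *: "g w (conn u v w) 1 = form \<epsilon> (pd u (pd v \<Psi>) w) (pd 1 \<Psi> w)"
    "g w (conn u v w) \<i> = form \<epsilon> (pd u (pd v \<Psi>) w) (pd \<i> \<Psi> w)"
    unfolding g_decompose [OF w, of "conn u v w"] g_commute [of w \<i> 1]
    by (simp_all only: conn_def complex.sel cramer)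
  show ?thesis
    using g_decompose [OF w, of x "conn u v w"] * pd_\<Psi>_decompose [OF w, of x]
    by (simp add: g_commute [of w 1 "conn u v w"] g_commute [of w \<i> "conn u v w"]
      g_commute [of w x "conn u v w"] form_bilinear_simps)
qed

lemma pd_g:
  assumes w: "w \<in> D"
  shows "pd u (\<lambda>z. g z v x) w =
    form \<epsilon> (pd u (pd v \<Psi>) w) (pd x \<Psi> w) + form \<epsilon> (pd u (pd x \<Psi>) w) (pd v \<Psi> w)"
  unfolding g_def using pd_form [OF pd_\<Psi>_diff [OF w, of v] pd_\<Psi>_diff [OF w, of x], of u \<epsilon>]
  by (simp add: form_commute [of \<epsilon> "pd v \<Psi> w" "pd u (pd x \<Psi>) w"])

text \<open>After \<open>pd_g\<close>, symmetry of second derivatives cancels all of Koszul's terms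
  except two copies of one. Uniqueness follows by pairing the difference of two solutions with
  itself, since \<open>g\<close> is positive.\<close>

lemma christoffel_eq_conn:
  assumes w: "w \<in> D"
  shows "christoffel g w u v = conn u v w"
  unfolding christoffel_def
proof (rule the_equality)
  have koszul: "pd u (\<lambda>z. g z v x) w + pd v (\<lambda>z. g z u x) w - pd x (\<lambda>z. g z u v) w
      = 2 * form \<epsilon> (pd u (pd v \<Psi>) w) (pd x \<Psi> w)" for x
    using pd_g [OF w] \<Psi>_commute [OF w, of x] \<Psi>_commute [OF w, of v u] by simp
  then show "\<forall>x. 2 * g w (conn u v w) x
      = pd u (\<lambda>z. g z v x) w + pd v (\<lambda>z. g z u x) w - pd x (\<lambda>z. g z u v) w"
    using g_conn [OF w] by simp
  fix y
  assume y: "\<forall>x. 2 * g w y x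
      = pd u (\<lambda>z. g z v x) w + pd v (\<lambda>z. g z u x) w - pd x (\<lambda>z. g z u v) w"
  have "g w (y - conn u v w) x = 0" for x
    using spec [OF y, of x] koszul [of x] g_conn [OF w, of u v x] g_decompose [OF w, of y x]
      g_decompose [OF w, of "conn u v w" x] g_decompose [OF w, of "y - conn u v w" x]
    by (simp add: algebra_simps)
  then show "y = conn u v w" using g_positive [OF w, of "y - conn u v w"] by fastforce
qed

lemma g_diff: "w \<in> D \<Longrightarrow> (\<lambda>z. g z u v) differentiable at w"
  unfolding g_def by (intro differentiable_form pd_\<Psi>_diff)

lemma W_diff: "w \<in> D \<Longrightarrow> W differentiable at w"
  unfolding W_def [abs_def] power2_eq_square
  by (intro differentiable_diff differentiable_mult g_diff)

lemma conn_diff: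
  assumes w: "w \<in> D"
  shows "conn u v differentiable at w"
  unfolding conn_def Complex_eq [abs_def] using w W_positive [OF w]
  by (intro differentiable_add differentiable_mult differentiable_const differentiable_divide
      differentiable_bounded_linear [OF bounded_linear_of_real] differentiable_diff g_diff
      differentiable_form pd_\<Psi>_diff pd_pd_\<Psi>_diff W_diff) auto

text \<open>\<open>V u v\<close> is the tangential part of \<open>\<Psi>\<^sub>u\<^sub>v\<close>; its derivative along \<open>x\<close> has tangential part
  \<open>\<nabla>\<^sub>x \<nabla>\<^sub>u v\<close>.\<close>

definition V :: "complex \<Rightarrow> complex \<Rightarrow> complex \<Rightarrow> real ^ 4" where
  "V u v w = pd (conn u v w) \<Psi> w"

lemma V_tangential: "w \<in> D \<Longrightarrow> form \<epsilon> (V u v w) (pd x \<Psi> w) = form \<epsilon> (pd u (pd v \<Psi>) w) (pd x \<Psi> w)"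
  unfolding V_def using g_conn by (simp add: g_def)

text \<open>The direction \<open>conn u v z\<close> varies with \<open>z\<close>, so
  \<open>V\<close> is expanded over the fixed directions 1 and \<i> before the product rule applies.
  In the last term of \<open>pd_V\<close> the direction is frozen at \<open>w\<close>.\<close>

lemma
  assumes w: "w \<in> D"
  shows V_diff: "V u v differentiable at w"
    and pd_V: "pd x (V u v) w = pd (pd x (conn u v) w) \<Psi> w + pd x (pd (conn u v w) \<Psi>) w"
proof -
  let ?V = "\<lambda>z. Re (conn u v z) *\<^sub>R pd 1 \<Psi> z + Im (conn u v z) *\<^sub>R pd \<i> \<Psi> z"
  have eq: "V u v z = ?V z" if "z \<in> D" for z
    unfolding V_def by (rule pd_\<Psi>_decompose [OF that])
  note re = pd_bounded_linear [OF bounded_linear_Re conn_diff [OF w], of x u v]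
    differentiable_bounded_linear [OF bounded_linear_Re conn_diff [OF w], of u v]
  note im = pd_bounded_linear [OF bounded_linear_Im conn_diff [OF w], of x u v]
    differentiable_bounded_linear [OF bounded_linear_Im conn_diff [OF w], of u v]
  note d1 = differentiable_bounded_bilinear [OF bounded_bilinear_scaleR re(2) pd_\<Psi>_diff [OF w, of 1]]
  note d2 = differentiable_bounded_bilinear [OF bounded_bilinear_scaleR im(2) pd_\<Psi>_diff [OF w, of \<i>]]
  have "?V differentiable at w" using d1 d2 by (rule differentiable_add)
  then show "V u v differentiable at w"
    unfolding differentiable_def
    using has_derivative_transform_within_open [OF _ open_D w, of ?V _ UNIV "V u v"] eq by auto
  have "pd x (V u v) w = pd x ?V w" by (rule pd_cong_open [OF open_D w]) (rule eq)
  also have "\<dots> = (Re (pd x (conn u v) w) *\<^sub>R pd 1 \<Psi> w + Im (pd x (conn u v) w) *\<^sub>R pd \<i> \<Psi> w)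
     + (Re (conn u v w) *\<^sub>R pd x (pd 1 \<Psi>) w + Im (conn u v w) *\<^sub>R pd x (pd \<i> \<Psi>) w)"
    unfolding pd_plus [OF d1 d2] pd_bounded_bilinear [OF bounded_bilinear_scaleR re(2) pd_\<Psi>_diff [OF w]]
      pd_bounded_bilinear [OF bounded_bilinear_scaleR im(2) pd_\<Psi>_diff [OF w]] re(1) im(1) by simp
  also have "\<dots> = pd (pd x (conn u v) w) \<Psi> w + pd (conn u v w) (pd x \<Psi>) w"
    using pd_\<Psi>_decompose [OF w, of "pd x (conn u v) w"] pd_decompose [OF pd_\<Psi>_diff [OF w], of "conn u v w" x]
      \<Psi>_commute [OF w, of x] by simp
  finally show "pd x (V u v) w = pd (pd x (conn u v) w) \<Psi> w + pd x (pd (conn u v w) \<Psi>) w"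
    using \<Psi>_commute [OF w, of x] by simp
qed

lemma pd_V_tangential:
  assumes w: "w \<in> D"
  shows "form \<epsilon> (pd x (V u v) w) (pd y \<Psi> w) =
    form \<epsilon> (pd x (pd u (pd v \<Psi>)) w) (pd y \<Psi> w)
    + form \<epsilon> (pd u (pd v \<Psi>) w - V u v w) (pd x (pd y \<Psi>) w)"
proof -
  have "pd x (\<lambda>z. form \<epsilon> (V u v z) (pd y \<Psi> z)) w = pd x (\<lambda>z. form \<epsilon> (pd u (pd v \<Psi>) z) (pd y \<Psi> z)) w"
    by (rule pd_cong_open [OF open_D w]) (rule V_tangential)
  then show ?thesis
    using pd_form [OF V_diff [OF w, of u v] pd_\<Psi>_diff [OF w, of y], of x \<epsilon>]
      pd_form [OF pd_pd_\<Psi>_diff [OF w, of u v] pd_\<Psi>_diff [OF w, of y], of x \<epsilon>]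
    by (simp add: form_bilinear_simps)
qed

text \<open>Gauss's equation in flat R^4: by \<open>pd_V_tangential\<close>, the third derivatives
  of \<open>\<Psi>\<close> cancel by symmetry, and only products with the normal parts of second
  derivatives remain.\<close>

lemma riemann_tensor_eq:
  assumes w: "w \<in> D"
  shows "g w (riemann_tensor g w u v x) y =
    form \<epsilon> (pd v (pd x \<Psi>) w - V v x w) (pd u (pd y \<Psi>) w)
    - form \<epsilon> (pd u (pd x \<Psi>) w - V u x w) (pd v (pd y \<Psi>) w)"
proof -
  have nabla: "g w (pd u (\<lambda>z. christoffel g z v x) w + christoffel g w u (christoffel g w v x)) y
      = form \<epsilon> (pd u (V v x) w) (pd y \<Psi> w)" for u v
  proof -
    have "pd u (\<lambda>z. christoffel g z v x) w = pd u (conn v x) w"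
      by (rule pd_cong_open [OF open_D w]) (rule christoffel_eq_conn)
    moreover have "g w (a + b) y = g w a y + g w b y" for a b
      using g_decompose [OF w, of "a + b" y] g_decompose [OF w, of a y] g_decompose [OF w, of b y]
      by (simp add: algebra_simps)
    ultimately show ?thesis
      using christoffel_eq_conn [OF w] g_conn [OF w, of u "conn v x w" y]
      by (simp add: pd_V [OF w] form_bilinear_simps g_def)
  qed
  have "g w (a - b) y = g w a y - g w b y" for a b
    using g_decompose [OF w, of "a - b" y] g_decompose [OF w, of a y] g_decompose [OF w, of b y]
    by (simp add: algebra_simps)
  moreover have "pd u (pd v (pd x \<Psi>)) w = pd v (pd u (pd x \<Psi>)) w"
    using pd_commute [OF smooth_on_pd [OF smooth_\<Psi>] open_D w] .
  ultimately show ?thesis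
    unfolding riemann_tensor_def using nabla pd_V_tangential [OF w] by simp
qed

lemma gauss_equation:
  assumes w: "w \<in> D"
  shows "gauss_curvature g w * W w =
    form \<epsilon> (pd 1 N w) (pd 1 \<Psi> w) * form \<epsilon> (pd \<i> N w) (pd \<i> \<Psi> w)
    - (form \<epsilon> (pd 1 N w) (pd \<i> \<Psi> w))\<^sup>2 + \<epsilon> * (N w $ 4)\<^sup>2 * W w"
proof -
  have W: "W w \<noteq> 0" using W_positive [OF w] by simp
  \<comment> \<open>The normal part of a second derivative in the basis \<open>N\<close>,
    \<open>\<eta>\<close>; the factor \<epsilon> is the inverse of the square of
    \<open>\<eta>\<close>.\<close>
  have normal: "form \<epsilon> (pd u (pd v \<Psi>) w - V u v w) x' =
     form \<epsilon> (pd u N w) (pd v \<Psi> w) * - form \<epsilon> x' (N w)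
     + \<epsilon> * (pd u \<Psi> w $ 4 * pd v \<Psi> w $ 4 - g w u v) * form \<epsilon> x' (\<eta> w)" for u v x'
  proof -
    have "form \<epsilon> (V u v w) (N w) = 0" "form \<epsilon> (V u v w) (\<eta> w) = 0"
      unfolding V_def using N_normal pd_\<Psi>_\<eta> w by simp_all
    then have "W w * form \<epsilon> (pd u (pd v \<Psi>) w - V u v w) x' = W w *
       (form \<epsilon> (pd u N w) (pd v \<Psi> w) * - form \<epsilon> x' (N w)
        + \<epsilon> * (pd u \<Psi> w $ 4 * pd v \<Psi> w $ 4 - g w u v) * form \<epsilon> x' (\<eta> w))"
      using frame [OF w, of "pd u (pd v \<Psi>) w - V u v w" x'] V_tangential [OF w]
        pd_pd_\<Psi>_N [OF w] pd_pd_\<Psi>_\<eta> [OF w]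
      by (simp add: form_bilinear_simps)
    then show ?thesis using W by simp
  qed
  have sym: "form \<epsilon> (pd \<i> N w) (pd 1 \<Psi> w) = form \<epsilon> (pd 1 N w) (pd \<i> \<Psi> w)"
    using pd_pd_\<Psi>_N [OF w, of 1 \<i>] pd_pd_\<Psi>_N [OF w, of \<i> 1] \<Psi>_commute [OF w, of 1 \<i>] by simp
  have "gauss_curvature g w * W w = g w (riemann_tensor g w 1 \<i> \<i>) 1"
    unfolding gauss_curvature_def using W by (simp add: W_def)
  \<comment> \<open>The \<open>\<eta>\<close> components contribute \<epsilon> ((h_s^2 - E)(h_t^2 -
    G) - (h_s h_t - F)^2). The quartic terms cancel, and what is subtracted from W is the right-hand
    side of \<open>vertical_norm\<close>.\<close>
  also have "\<dots> = form \<epsilon> (pd 1 N w) (pd 1 \<Psi> w) * form \<epsilon> (pd \<i> N w) (pd \<i> \<Psi> w)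
      - (form \<epsilon> (pd 1 N w) (pd \<i> \<Psi> w))\<^sup>2
      + \<epsilon> * (W w - (g w \<i> \<i> * (pd 1 \<Psi> w $ 4)\<^sup>2
    - 2 * g w 1 \<i> * pd 1 \<Psi> w $ 4 * pd \<i> \<Psi> w $ 4 + g w 1 1 * (pd \<i> \<Psi> w $ 4)\<^sup>2))"
    unfolding riemann_tensor_eq [OF w] normal pd_pd_\<Psi>_N [OF w] pd_pd_\<Psi>_\<eta> [OF w] sym
      g_commute [of w \<i> 1] W_def
    by (simp add: power2_eq_square algebra_simps)
  finally show ?thesis
    unfolding vertical_norm [OF w, symmetric] by (simp add: algebra_simps)
qed

end

section \<open>The Laplacian in conformal parameters for the second fundamental form\<close>

lemma holomorphic_on_Complex:
  fixes P R :: "complex \<Rightarrow> real"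
  assumes "open D"
    and diff: "\<And>w. w \<in> D \<Longrightarrow> P differentiable at w" "\<And>w. w \<in> D \<Longrightarrow> R differentiable at w"
    and CR: "\<And>w. w \<in> D \<Longrightarrow> pd 1 P w = pd \<i> R w" "\<And>w. w \<in> D \<Longrightarrow> pd \<i> P w = - pd 1 R w"
  shows "(\<lambda>w. Complex (P w) (R w)) holomorphic_on D"
proof -
  have "((\<lambda>w. Complex (P w) (R w)) has_field_derivative Complex (pd 1 P w) (pd 1 R w)) (at w)"
    if w: "w \<in> D" for w
  proof -
    have "((\<lambda>w. of_real (P w) + \<i> * of_real (R w)) has_derivative
        (\<lambda>u. of_real (pd u P w) + \<i> * of_real (pd u R w))) (at w)"
      by (intro has_derivative_add has_derivative_mult_right has_derivative_of_real
          pd_has_derivative diff [OF w])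
    also have "(\<lambda>u. of_real (pd u P w) + \<i> * of_real (pd u R w)) = (*) (Complex (pd 1 P w) (pd 1 R w))"
    proof
      fix u
      show "of_real (pd u P w) + \<i> * of_real (pd u R w) = Complex (pd 1 P w) (pd 1 R w) * u"
        using pd_decompose [OF diff(1) [OF w], of u] pd_decompose [OF diff(2) [OF w], of u] CR [OF w]
        by (simp add: complex_eq_iff algebra_simps)
    qed
    finally show ?thesis
      unfolding has_field_derivative_def Complex_eq [of "P _"] .
  qed
  then show ?thesis
    unfolding holomorphic_on_open [OF \<open>open D\<close>] by blast
qed

lemma dz_vec_nth:
  assumes "f differentiable at w"
  shows "dz_vec f w $ k = (of_real (pd 1 f w $ k) - \<i> * of_real (pd \<i> f w $ k)) / 2"
proof -
  have "pd u (\<lambda>z. of_real (f z $ k) :: complex) w = of_real (pd u f w $ k)" for u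
    by (rule pd_bounded_linear [OF bounded_linear_compose [OF bounded_linear_of_real bounded_linear_vec_nth] assms])
  then show ?thesis by (simp add: dz_vec_def dz_def)
qed

lemma form_dz_vec:
  assumes "f differentiable at w"
  shows "form \<epsilon> (dz_vec f w) (dz_vec f w) =
    Complex ((form \<epsilon> (pd 1 f w) (pd 1 f w) - form \<epsilon> (pd \<i> f w) (pd \<i> f w)) / 4)
      (- form \<epsilon> (pd 1 f w) (pd \<i> f w) / 2)"
  unfolding form_def dz_vec_nth [OF assms] complex_eq_iff
  by (simp add: algebra_simps add_divide_distrib diff_divide_distrib)

locale conformal_immersion = local_immersion +
  fixes K :: real
  assumes curvature: "w \<in> D \<Longrightarrow> gauss_curvature g w = K"
    and K_gt: "K > 0" "K - \<epsilon> > 0"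
    and conformal: "w \<in> D \<Longrightarrow> \<exists>r. r \<noteq> 0 \<and> (\<forall>u v. form \<epsilon> (- pd u N w) (pd v \<Psi> w) = r * (u \<bullet> v))"
begin

section \<open>Gauss, Codazzi and Weingarten equations in conformal parameters\<close>

definition r :: "complex \<Rightarrow> real" where
  "r w = - form \<epsilon> (pd 1 N w) (pd 1 \<Psi> w)"

lemma
  assumes w: "w \<in> D"
  shows r_nonzero: "r w \<noteq> 0"
    and pd_N_pd_\<Psi>: "form \<epsilon> (pd u N w) (pd v \<Psi> w) = - r w * (u \<bullet> v)"
proof -
  obtain s where s: "s \<noteq> 0" "\<And>u v. form \<epsilon> (- pd u N w) (pd v \<Psi> w) = s * (u \<bullet> v)"
    using conformal [OF w] by blast
  have *: "form \<epsilon> (pd u N w) (pd v \<Psi> w) = - s * (u \<bullet> v)" for u v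
    using s(2) [of u v] by (simp add: form_bilinear_simps)
  then have "r w = s" by (simp add: r_def)
  with s * show "r w \<noteq> 0" "form \<epsilon> (pd u N w) (pd v \<Psi> w) = - r w * (u \<bullet> v)" by simp_all
qed

lemma r_square: "w \<in> D \<Longrightarrow> (K - \<epsilon> * (N w $ 4)\<^sup>2) * W w = (r w)\<^sup>2"
  using gauss_equation [of w] curvature [of w] pd_N_pd_\<Psi> [of w]
  by (simp add: power2_eq_square algebra_simps)

lemma r_diff: "w \<in> D \<Longrightarrow> r differentiable at w"
  unfolding r_def [abs_def] by (intro differentiable_minus differentiable_form pd_N_diff pd_\<Psi>_diff)

lemma N_nth_diff: "w \<in> D \<Longrightarrow> (\<lambda>z. N z $ k) differentiable at w"
  by (rule differentiable_bounded_linear [OF bounded_linear_vec_nth N_diff])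

lemma pd_N_nth: "w \<in> D \<Longrightarrow> pd u (\<lambda>z. N z $ k) w = pd u N w $ k"
  by (rule pd_bounded_linear [OF bounded_linear_vec_nth N_diff])

lemma pd_\<Psi>_nth_diff: "w \<in> D \<Longrightarrow> (\<lambda>z. pd u \<Psi> z $ k) differentiable at w"
  by (rule differentiable_bounded_linear [OF bounded_linear_vec_nth pd_\<Psi>_diff])

lemma pd_pd_\<Psi>_nth: "w \<in> D \<Longrightarrow> pd u (\<lambda>z. pd v \<Psi> z $ k) w = pd u (pd v \<Psi>) w $ k"
  by (rule pd_bounded_linear [OF bounded_linear_vec_nth pd_\<Psi>_diff])

text \<open>Differentiating \<open>r\<close> along \<open>a\<close> and the vanishing product of
  \<open>pd a N\<close> and \<open>pd b \<Psi>\<close> along \<open>b\<close> brings in the same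
  second derivative of \<open>N\<close>, which is eliminated. Allowing both orders of the pair lets
  one computation serve both coordinate directions.\<close>

lemma codazzi:
  assumes w: "w \<in> D" and ab: "(a, b) = (1, \<i>) \<or> (a, b) = (\<i>, 1)"
  shows "pd a r w = form \<epsilon> (pd a N w) (pd b (pd b \<Psi>) w) - form \<epsilon> (pd b N w) (pd a (pd b \<Psi>) w)"
proof -
  have "pd a r w = pd a (\<lambda>z. - form \<epsilon> (pd b N z) (pd b \<Psi> z)) w"
    by (rule pd_cong_open [OF open_D w]) (use ab pd_N_pd_\<Psi> in auto)
  also have "\<dots> = - (form \<epsilon> (pd a (pd b N) w) (pd b \<Psi> w) + form \<epsilon> (pd b N w) (pd a (pd b \<Psi>) w))"
    unfolding pd_uminus [OF differentiable_form [OF pd_N_diff [OF w] pd_\<Psi>_diff [OF w]]]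
      pd_form [OF pd_N_diff [OF w] pd_\<Psi>_diff [OF w]] ..
  also have "form \<epsilon> (pd a (pd b N) w) (pd b \<Psi> w) = - form \<epsilon> (pd a N w) (pd b (pd b \<Psi>) w)"
  proof -
    have "pd b (\<lambda>z. form \<epsilon> (pd a N z) (pd b \<Psi> z)) w = 0"
      by (rule pd_zero_on [OF w]) (use ab pd_N_pd_\<Psi> in auto)
    then show ?thesis
      unfolding pd_form [OF pd_N_diff [OF w] pd_\<Psi>_diff [OF w]] N_commute [OF w, of a b] by simp
  qed
  finally show ?thesis by simp
qed

lemma
  assumes w: "w \<in> D" and ab: "(a, b) = (1, \<i>) \<or> (a, b) = (\<i>, 1)"
  shows frame_swap: "W w * form \<epsilon> v v' =
      g w b b * form \<epsilon> v (pd a \<Psi> w) * form \<epsilon> v' (pd a \<Psi> w)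
      - g w a b * (form \<epsilon> v (pd a \<Psi> w) * form \<epsilon> v' (pd b \<Psi> w) + form \<epsilon> v (pd b \<Psi> w) * form \<epsilon> v' (pd a \<Psi> w))
      + g w a a * form \<epsilon> v (pd b \<Psi> w) * form \<epsilon> v' (pd b \<Psi> w)
      + W w * (form \<epsilon> v (N w) * form \<epsilon> v' (N w) + \<epsilon> * form \<epsilon> v (\<eta> w) * form \<epsilon> v' (\<eta> w))"
    and W_swap: "W w = g w a a * g w b b - (g w a b)\<^sup>2"
  using ab frame [OF w, of v v'] g_commute [of w \<i> 1] by (auto simp: W_def)

text \<open>The Gauss equation differentiated along \<open>a\<close> yields one scalar relation, the
  vanishing of one contravariant component of \<open>X\<close> times W. Exchanging \<open>a\<close>
  and \<open>b\<close> supplies the other.\<close>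

lemma laplacian_aux:
  assumes w: "w \<in> D" and ab: "(a, b) = (1, \<i>) \<or> (a, b) = (\<i>, 1)"
  defines "X \<equiv> \<lambda>u. r w * form \<epsilon> (pd a (pd a \<Psi>) w + pd b (pd b \<Psi>) w) (pd u \<Psi> w)
    + 2 * \<epsilon> * N w $ 4 * W w * pd u \<Psi> w $ 4"
  shows "g w b b * X a = g w a b * X b"
proof -
  define E F G where EFG: "E = g w a a" "F = g w a b" "G = g w b b"
  define A1 A2 where A: "A1 = form \<epsilon> (pd a (pd a \<Psi>) w) (pd a \<Psi> w)" "A2 = form \<epsilon> (pd a (pd a \<Psi>) w) (pd b \<Psi> w)"
  define B1 B2 where B: "B1 = form \<epsilon> (pd a (pd b \<Psi>) w) (pd a \<Psi> w)" "B2 = form \<epsilon> (pd a (pd b \<Psi>) w) (pd b \<Psi> w)"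
  define C1 C2 where C: "C1 = form \<epsilon> (pd b (pd b \<Psi>) w) (pd a \<Psi> w)" "C2 = form \<epsilon> (pd b (pd b \<Psi>) w) (pd b \<Psi> w)"
  define \<rho> \<nu> \<omega> ha hb where abbr: "\<rho> = r w" "\<nu> = N w $ 4" "\<omega> = W w" "ha = pd a \<Psi> w $ 4" "hb = pd b \<Psi> w $ 4"
  have ip: "a \<bullet> a = 1" "b \<bullet> b = 1" "a \<bullet> b = 0" "b \<bullet> a = 0" using ab by auto
  have "\<omega> \<noteq> 0" "\<rho> \<noteq> 0" using W_positive [OF w] r_nonzero [OF w] by (auto simp: abbr)
  have "\<omega> * form \<epsilon> (pd a N w) (pd b (pd b \<Psi>) w) = - \<rho> * (G * C1 - F * C2) - \<omega> * \<epsilon> * \<nu> * ha * (G - hb * hb)"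
    using frame_swap [OF w ab, of "pd a N w" "pd b (pd b \<Psi>) w"] pd_N_pd_\<Psi> [OF w] pd_N_N [OF w]
      pd_N_\<eta> [OF w] pd_pd_\<Psi>_\<eta> [OF w] ip
    unfolding EFG C abbr by (simp add: algebra_simps)
  moreover have "\<omega> * form \<epsilon> (pd b N w) (pd a (pd b \<Psi>) w) = - \<rho> * (E * B2 - F * B1) - \<omega> * \<epsilon> * \<nu> * hb * (F - ha * hb)"
    using frame_swap [OF w ab, of "pd b N w" "pd a (pd b \<Psi>) w"] pd_N_pd_\<Psi> [OF w] pd_N_N [OF w]
      pd_N_\<eta> [OF w] pd_pd_\<Psi>_\<eta> [OF w] ip
    unfolding EFG B abbr by (simp add: algebra_simps)
  ultimately have dr: "\<omega> * pd a r w = - \<rho> * (G * C1 - F * C2 + F * B1 - E * B2) - \<omega> * \<epsilon> * \<nu> * (G * ha - F * hb)"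
    unfolding codazzi [OF w ab] by (simp add: algebra_simps)
  \<comment> \<open>Weingarten's equation: nu is the product of \<open>N\<close> with the constant
    vertical vector.\<close>
  have d\<nu>: "\<omega> * pd a N w $ 4 = - \<rho> * (G * ha - F * hb)"
    using frame_swap [OF w ab, of "pd a N w" "axis 4 1"] pd_N_pd_\<Psi> [OF w] pd_N_N [OF w] ip
      form_commute [of \<epsilon> "axis 4 1"] form_vertical [of \<epsilon>]
    unfolding EFG abbr by (simp add: algebra_simps horizontal_def)
  have dW: "pd a W w = 2 * (A1 * G + E * B2 - F * A2 - F * B1)"
  proof -
    have "pd a W w = pd a (\<lambda>z. g z a a * g z b b - g z a b * g z a b) w"
      by (rule pd_cong_open [OF open_D w]) (use W_swap [OF _ ab] in \<open>auto simp: power2_eq_square\<close>)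
    then show ?thesis
      using pd_minus [OF differentiable_mult differentiable_mult, OF g_diff g_diff g_diff g_diff, OF w w w w]
        pd_mult [OF g_diff g_diff, OF w w] pd_g [OF w]
      unfolding EFG A B by (simp add: algebra_simps)
  qed
  have "pd a (\<lambda>z. (K - \<epsilon> * (N z $ 4 * N z $ 4)) * W z) w = pd a (\<lambda>z. r z * r z) w"
    by (rule pd_cong_open [OF open_D w]) (use r_square in \<open>auto simp: power2_eq_square\<close>)
  moreover have "pd a (\<lambda>z. r z * r z) w = 2 * \<rho> * pd a r w"
    using pd_mult [OF r_diff r_diff, OF w w] by (simp add: abbr)
  moreover have "pd a (\<lambda>z. (K - \<epsilon> * (N z $ 4 * N z $ 4)) * W z) w
      = (K - \<epsilon> * (\<nu> * \<nu>)) * pd a W w - 2 * \<epsilon> * \<nu> * pd a N w $ 4 * \<omega>"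
  proof -
    note d1 = N_nth_diff [OF w, of 4]
    note d2 = differentiable_mult [OF d1 d1]
    note d3 = differentiable_mult [OF differentiable_const [of \<epsilon> "at w"] d2]
    note d4 = differentiable_diff [OF differentiable_const [of K "at w"] d3]
    show ?thesis
      unfolding pd_mult [OF d4 W_diff [OF w]] pd_minus [OF differentiable_const d3]
        pd_mult [OF differentiable_const d2] pd_mult [OF d1 d1] pd_N_nth [OF w] abbr
      by (simp add: algebra_simps)
  qed
  ultimately have "(K - \<epsilon> * (\<nu> * \<nu>)) * pd a W w - 2 * \<epsilon> * \<nu> * pd a N w $ 4 * \<omega> = 2 * \<rho> * pd a r w"
    by simp
  \<comment> \<open>The derivatives of \<open>r\<close> and nu are known only after multiplication
    by W; the same factor turns the first coefficient into \<rho>^2 by the Gauss equation.\<close>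
  then have "((K - \<epsilon> * (\<nu> * \<nu>)) * \<omega>) * pd a W w - 2 * \<epsilon> * \<nu> * (\<omega> * pd a N w $ 4) * \<omega> = 2 * \<rho> * (\<omega> * pd a r w)"
    by algebra
  moreover have r2: "(K - \<epsilon> * (\<nu> * \<nu>)) * \<omega> = \<rho> * \<rho>"
    using r_square [OF w] by (simp add: abbr power2_eq_square)
  \<comment> \<open>The terms E B2 - F B1 of \<open>dW\<close> and \<open>dr\<close> cancel; the
    \<epsilon> terms coming from \<open>d\<nu>\<close> and \<open>dr\<close> are equal and add up to
    the factor 2.\<close>
  ultimately have "(2 * \<rho>) * (\<rho> * (G * (A1 + C1) - F * (A2 + C2)) + 2 * \<epsilon> * \<nu> * \<omega> * (G * ha - F * hb)) = 0"
    unfolding r2 dW d\<nu> dr by (simp add: algebra_simps)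
  then have "\<rho> * (G * (A1 + C1) - F * (A2 + C2)) + 2 * \<epsilon> * \<nu> * \<omega> * (G * ha - F * hb) = 0"
    using \<open>\<rho> \<noteq> 0\<close> by simp
  then show ?thesis
    unfolding X_def EFG [symmetric] abbr [symmetric]
    using A B C by (simp add: form_bilinear_simps algebra_simps)
qed

definition \<Delta> :: "complex \<Rightarrow> real ^ 4" where
  "\<Delta> w = pd 1 (pd 1 \<Psi>) w + pd \<i> (pd \<i> \<Psi>) w"

text \<open>The two instances of \<open>laplacian_aux\<close> form a homogeneous linear system with
  determinant W, which is positive.\<close>

lemma laplacian_tangential:
  assumes w: "w \<in> D" and u: "u \<in> {1, \<i>}"
  shows "r w * form \<epsilon> (\<Delta> w) (pd u \<Psi> w) = - 2 * \<epsilon> * N w $ 4 * W w * pd u \<Psi> w $ 4"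
proof -
  define X where "X u = r w * form \<epsilon> (\<Delta> w) (pd u \<Psi> w) + 2 * \<epsilon> * N w $ 4 * W w * pd u \<Psi> w $ 4" for u
  have eqs: "g w \<i> \<i> * X 1 = g w 1 \<i> * X \<i>" "g w 1 1 * X \<i> = g w 1 \<i> * X 1"
    using laplacian_aux [OF w, of 1 \<i>] laplacian_aux [OF w, of \<i> 1] g_commute [of w \<i> 1]
    by (simp_all add: X_def \<Delta>_def add.commute)
  have "W w * X 1 = 0" "W w * X \<i> = 0"
    using eqs unfolding W_def power2_eq_square by algebra+
  then have "X u = 0" using W_positive [OF w] u by auto
  then show ?thesis by (simp add: X_def)
qed

text \<open>The product of the Laplacian with the vertical vector, expanded in the frame. The
  tangential terms add up to - 2 \<epsilon> nu W (1 - nu^2) by \<open>vertical_norm\<close>, the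
  normal term is 2 r^2 nu, and with \<open>r_square\<close> the cubic terms in nu cancel.\<close>

lemma laplacian_height:
  assumes w: "w \<in> D"
  shows "r w * \<Delta> w $ 4 = 2 * N w $ 4 * W w * (K - \<epsilon>)"
proof -
  have *: "form \<epsilon> (axis 4 1) x = x $ 4" for x :: "real ^ 4"
    using form_vertical form_commute by metis
  have "form \<epsilon> (\<Delta> w) (N w) = 2 * r w"
    unfolding \<Delta>_def using pd_pd_\<Psi>_N [OF w] pd_N_pd_\<Psi> [OF w] by (simp add: form_bilinear_simps)
  moreover have "\<eta> w $ 4 = 0" by (simp add: horizontal_def)
  ultimately have "W w * \<Delta> w $ 4 =
      g w \<i> \<i> * form \<epsilon> (\<Delta> w) (pd 1 \<Psi> w) * pd 1 \<Psi> w $ 4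
      - g w 1 \<i> * (form \<epsilon> (\<Delta> w) (pd 1 \<Psi> w) * pd \<i> \<Psi> w $ 4 + form \<epsilon> (\<Delta> w) (pd \<i> \<Psi> w) * pd 1 \<Psi> w $ 4)
      + g w 1 1 * form \<epsilon> (\<Delta> w) (pd \<i> \<Psi> w) * pd \<i> \<Psi> w $ 4
      + W w * (2 * r w * N w $ 4)"
    using frame [OF w, of "\<Delta> w" "axis 4 1"] unfolding * form_vertical by simp
  then have "W w * (r w * \<Delta> w $ 4) =
      g w \<i> \<i> * (r w * form \<epsilon> (\<Delta> w) (pd 1 \<Psi> w)) * pd 1 \<Psi> w $ 4
      - g w 1 \<i> * ((r w * form \<epsilon> (\<Delta> w) (pd 1 \<Psi> w)) * pd \<i> \<Psi> w $ 4 + (r w * form \<epsilon> (\<Delta> w) (pd \<i> \<Psi> w)) * pd 1 \<Psi> w $ 4)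
      + g w 1 1 * (r w * form \<epsilon> (\<Delta> w) (pd \<i> \<Psi> w)) * pd \<i> \<Psi> w $ 4
      + W w * (2 * (r w)\<^sup>2 * N w $ 4)"
    by algebra
  also have "\<dots> = W w * (- 2 * \<epsilon> * N w $ 4 * (W w * (1 - (N w $ 4)\<^sup>2)) + 2 * (r w)\<^sup>2 * N w $ 4)"
    unfolding vertical_norm [OF w] using laplacian_tangential [OF w]
    by (simp add: power2_eq_square algebra_simps)
  also have "\<dots> = W w * (2 * N w $ 4 * W w * (K - \<epsilon>))"
    unfolding r_square [OF w, symmetric] by (simp add: power2_eq_square algebra_simps)
  finally show ?thesis using W_positive [OF w] by simp
qed

lemma laplacian_identity:
  assumes w: "w \<in> D" and u: "u \<in> {1, \<i>}"
  shows "form \<epsilon> (\<Delta> w) (pd u \<Psi> w) + 1 / (\<epsilon> * K - 1) * pd u \<Psi> w $ 4 * \<Delta> w $ 4 = 0"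
proof -
  define \<kappa> where "\<kappa> = 1 / (\<epsilon> * K - 1)"
  have \<kappa>: "\<kappa> * (K - \<epsilon>) = \<epsilon>"
    using eps K_gt by (auto simp: \<kappa>_def field_simps)
  have "r w * (form \<epsilon> (\<Delta> w) (pd u \<Psi> w) + \<kappa> * pd u \<Psi> w $ 4 * \<Delta> w $ 4)
      = r w * form \<epsilon> (\<Delta> w) (pd u \<Psi> w) + \<kappa> * pd u \<Psi> w $ 4 * (r w * \<Delta> w $ 4)"
    by (simp add: algebra_simps)
  also have "\<dots> = 2 * N w $ 4 * W w * pd u \<Psi> w $ 4 * (\<kappa> * (K - \<epsilon>) - \<epsilon>)"
    unfolding laplacian_tangential [OF w u] laplacian_height [OF w] by (simp add: algebra_simps)
  also have "\<dots> = 0" unfolding \<kappa> by simp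
  finally show ?thesis using r_nonzero [OF w] by (simp add: \<kappa>_def)
qed

lemma coefficient_holomorphic:
  "(\<lambda>z. form \<epsilon> (dz_vec \<Psi> z) (dz_vec \<Psi> z)
     + of_real (1 / (\<epsilon> * K - 1)) * (dz (\<lambda>w. of_real (\<Psi> w $ 4)) z)\<^sup>2) holomorphic_on D"
proof -
  define \<kappa> where "\<kappa> = 1 / (\<epsilon> * K - 1)"
  \<comment> \<open>\<open>P\<close> and \<open>R\<close> are the real and imaginary parts of the
    coefficient, since h_z^2 = (h_s^2 - h_t^2) / 4 - \<i> h_s h_t / 2.\<close>
  define P where "P z = (g z 1 1 - g z \<i> \<i> + \<kappa> * (pd 1 \<Psi> z $ 4 * pd 1 \<Psi> z $ 4 - pd \<i> \<Psi> z $ 4 * pd \<i> \<Psi> z $ 4)) / 4" for z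
  define R where "R z = - (g z 1 \<i> + \<kappa> * (pd 1 \<Psi> z $ 4 * pd \<i> \<Psi> z $ 4)) / 2" for z
  have P: "(P has_derivative (\<lambda>u. (pd u (\<lambda>z. g z 1 1) w - pd u (\<lambda>z. g z \<i> \<i>) w
      + \<kappa> * (2 * (pd 1 \<Psi> w $ 4 * pd u (pd 1 \<Psi>) w $ 4) - 2 * (pd \<i> \<Psi> w $ 4 * pd u (pd \<i> \<Psi>) w $ 4))) / 4)) (at w)"
    if w: "w \<in> D" for w
    unfolding P_def [abs_def]
    by (rule derivative_eq_intros pd_has_derivative g_diff pd_\<Psi>_nth_diff w refl)+
      (simp_all add: pd_pd_\<Psi>_nth [OF w] fun_eq_iff)
  have R: "(R has_derivative (\<lambda>u. - (pd u (\<lambda>z. g z 1 \<i>) w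
      + \<kappa> * (pd 1 \<Psi> w $ 4 * pd u (pd \<i> \<Psi>) w $ 4 + pd u (pd 1 \<Psi>) w $ 4 * pd \<i> \<Psi> w $ 4)) / 2)) (at w)"
    if w: "w \<in> D" for w
    unfolding R_def [abs_def]
    by (rule derivative_eq_intros pd_has_derivative g_diff pd_\<Psi>_nth_diff w refl)+
      (simp_all add: pd_pd_\<Psi>_nth [OF w] fun_eq_iff)
  have "(\<lambda>z. Complex (P z) (R z)) holomorphic_on D"
  proof (rule holomorphic_on_Complex [OF open_D])
    fix w assume w: "w \<in> D"
    show "P differentiable at w" "R differentiable at w"
      using P [OF w] R [OF w] differentiableI by blast+
    note ids = laplacian_identity [OF w, of 1, folded \<kappa>_def] laplacian_identity [OF w, of \<i>, folded \<kappa>_def]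
    \<comment> \<open>The differences \<open>pd 1 P w - pd \<i> R w\<close> and
      \<open>pd \<i> P w + pd 1 R w\<close> are 1/2 and -1/2 times the left-hand side of
      \<open>laplacian_identity\<close> for 1 and \<i>.\<close>
    show "pd 1 P w = pd \<i> R w" "pd \<i> P w = - pd 1 R w"
      unfolding pd_eq [OF P [OF w]] pd_eq [OF R [OF w]] pd_g [OF w] \<Psi>_commute [OF w, of \<i> 1]
      using ids unfolding \<Delta>_def
      by (simp_all add: form_bilinear_simps algebra_simps add_divide_distrib diff_divide_distrib)
  qed
  moreover have "Complex (P z) (R z) = form \<epsilon> (dz_vec \<Psi> z) (dz_vec \<Psi> z)
     + of_real (1 / (\<epsilon> * K - 1)) * (dz (\<lambda>w. of_real (\<Psi> w $ 4)) z)\<^sup>2" if z: "z \<in> D" for z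
  proof -
    have dz: "dz (\<lambda>w. of_real (\<Psi> w $ 4)) z = Complex (pd 1 \<Psi> z $ 4 / 2) (- pd \<i> \<Psi> z $ 4 / 2)"
      using dz_vec_nth [OF \<Psi>_diff [OF z], of 4] by (simp add: dz_vec_def complex_eq_iff)
    show ?thesis
      unfolding dz form_dz_vec [OF \<Psi>_diff [OF z]]
        P_def R_def \<kappa>_def [symmetric] g_def
      by (simp add: complex_eq_iff power2_eq_square field_simps)
  qed
  ultimately show ?thesis by (rule holomorphic_transform)
qed

end

section \<open>Changes of charts\<close>

lemma
  assumes "is_chart X c"
  shows chart_inj: "inj_on (snd c) (fst c)"
    and open_chart_image: "open (chart_image c)"
    and open_overlap: "is_chart X d \<Longrightarrow> open (overlap c d)"
    and chart_subset: "fst c \<subseteq> topspace X"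
proof -
  show sub: "fst c \<subseteq> topspace X" and op: "open (chart_image c)"
    using assms openin_subset by (auto simp: is_chart_def)
  have hom: "homeomorphic_map (subtopology X (fst c)) (top_of_set (chart_image c)) (snd c)"
    using assms by (simp add: is_chart_def)
  show "inj_on (snd c) (fst c)"
    using homeomorphic_imp_injective_map [OF hom] sub by (simp add: Int_absorb1)
  assume "is_chart X d"
  then have "openin X (fst d)" by (simp add: is_chart_def)
  then have "openin (subtopology X (fst c)) (fst c \<inter> fst d)"
    by (auto simp: openin_subtopology)
  then have "openin (top_of_set (chart_image c)) (overlap c d)"
    using homeomorphic_imp_open_map [OF hom] by (simp add: overlap_def open_map_def)
  then show "open (overlap c d)" using op openin_open_trans by blast
qed

lemma in_chart_apply: "inj_on (snd c) (fst c) \<Longrightarrow> p \<in> fst c \<Longrightarrow> in_chart c f (snd c p) = f p"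
  by (simp add: in_chart_def)

lemma in_chart_image:
  assumes "w \<in> chart_image c"
  shows "in_chart c f w = f (inv_into (fst c) (snd c) w)" "inv_into (fst c) (snd c) w \<in> fst c"
  using assms by (auto simp: in_chart_def chart_image_def intro: inv_into_into)

lemma overlap_subset: "overlap c d \<subseteq> chart_image c"
  by (auto simp: overlap_def chart_image_def)

lemma in_chart_transition:
  assumes "inj_on (snd c) (fst c)" "inj_on (snd d) (fst d)" "w \<in> overlap c d"
  shows "in_chart c f w = in_chart d f (transition c d w)"
  using assms by (auto simp: overlap_def transition_def in_chart_apply)

lemma transition_in_overlap:
  assumes "inj_on (snd c) (fst c)" "w \<in> overlap c d"
  shows "transition c d w \<in> overlap d c"
  using assms by (auto simp: overlap_def transition_def in_chart_apply)

text \<open>Lagrange's identity gives J^2 = |p|^4 for the determinant J, and positivity selects J =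
  |p|^2. Then |q - \<i> p|^2 = |p|^2 + |q|^2 - 2 J = 0.\<close>

lemma conformal_complex_linear:
  fixes p q :: complex
  assumes "p \<bullet> p = q \<bullet> q" "p \<bullet> q = 0" "Re p * Im q - Im p * Re q > 0"
  shows "q = \<i> * p"
proof -
  define J where "J = Re p * Im q - Im p * Re q"
  have "J\<^sup>2 = (p \<bullet> p) * (q \<bullet> q) - (p \<bullet> q)\<^sup>2"
    by (simp add: J_def inner_complex_def power2_eq_square algebra_simps)
  also have "\<dots> = (p \<bullet> p)\<^sup>2" using assms(1,2) by (simp add: power2_eq_square)
  finally have "J = p \<bullet> p"
    using assms(3) by (simp add: J_def)
  moreover have "(Re q + Im p)\<^sup>2 + (Im q - Re p)\<^sup>2 = p \<bullet> p + q \<bullet> q - 2 * J"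
    by (simp add: J_def inner_complex_def power2_eq_square algebra_simps)
  ultimately have "(Re q + Im p)\<^sup>2 + (Im q - Re p)\<^sup>2 = 0"
    using assms(1) by simp
  then have "Re q + Im p = 0" "Im q - Re p = 0" by (simp_all only: sum_power2_eq_zero_iff)
  then show ?thesis by (simp add: complex_eq_iff)
qed

lemma jacobian_chain:
  assumes "f differentiable at w" "g differentiable at (f w)"
  shows "jacobian (\<lambda>z. g (f z)) w = jacobian g (f w) * jacobian f w"
  unfolding jacobian_def pd_chain [OF assms]
    pd_decompose [OF assms(2), of "pd 1 f w"] pd_decompose [OF assms(2), of "pd \<i> f w"]
  by (simp add: algebra_simps)

lemma
  assumes "f differentiable at w" "pd \<i> f w = \<i> * pd 1 f w"
  shows has_field_derivative_pd: "(f has_field_derivative pd 1 f w) (at w)"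
    and deriv_pd: "deriv f w = pd 1 f w"
proof -
  have "(\<lambda>u. pd u f w) = (*) (pd 1 f w)"
  proof
    fix u
    show "pd u f w = pd 1 f w * u"
      using pd_decompose [OF assms(1), of u] assms(2) by (simp add: complex_eq_iff algebra_simps)
  qed
  then show "(f has_field_derivative pd 1 f w) (at w)"
    using pd_has_derivative [OF assms(1)] by (simp add: has_field_derivative_def)
  then show "deriv f w = pd 1 f w" by (rule DERIV_imp_deriv)
qed

text \<open>The Cauchy-Riemann condition kills the conjugate derivative of \<open>f\<close>, leaving
  a single term of the chain rule for the complex derivative.\<close>

lemma dz_vec_chain:
  assumes "f differentiable at w" "g differentiable at (f w)" "pd \<i> f w = \<i> * pd 1 f w"
  shows "dz_vec (\<lambda>z. g (f z)) w $ k = dz_vec g (f w) $ k * pd 1 f w"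
proof -
  have diff: "(\<lambda>z. g (f z)) differentiable at w"
    using differentiable_chain_at [OF assms(1,2)] by (simp add: o_def)
  show ?thesis
    unfolding dz_vec_nth [OF assms(2)] dz_vec_nth [OF diff] pd_chain [OF assms(1,2)] assms(3)
      pd_decompose [OF assms(2), of "pd 1 f w"] pd_decompose [OF assms(2), of "\<i> * pd 1 f w"]
    by (simp add: complex_eq_iff algebra_simps add_divide_distrib diff_divide_distrib)
qed

lemma dz_vec_cong_open:
  assumes "open D" "w \<in> D" "\<And>z. z \<in> D \<Longrightarrow> f z = g z"
  shows "dz_vec f w = dz_vec g w"
proof -
  have "pd u (\<lambda>z. of_real (f z $ k) :: complex) w = pd u (\<lambda>z. of_real (g z $ k)) w" for u k
    by (rule pd_cong_open [OF assms(1,2)]) (simp add: assms(3))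
  then show ?thesis by (simp add: dz_vec_def dz_def)
qed

lemma form_mult_right:
  fixes x y :: "complex ^ 4"
  assumes "\<And>k. y $ k = x $ k * a"
  shows "form \<epsilon> y y = form \<epsilon> x x * a\<^sup>2"
  by (simp add: form_def assms power2_eq_square algebra_simps)

section \<open>The quadratic form\<close>

lemma local_immersion_in_chart:
  assumes "\<epsilon> \<in> {1, -1}" "smooth_surface X A" "immersion X A \<epsilon> \<psi>" "unit_normal X A \<epsilon> \<psi> N" "c \<in> A"
  shows "local_immersion (chart_image c) (in_chart c \<psi>) (in_chart c N) \<epsilon>"
proof
  have c: "is_chart X c" using assms(2,5) by (simp add: smooth_surface_def)
  show "\<epsilon> \<in> {1, -1}" by fact
  show "open (chart_image c)" using open_chart_image [OF c] .
  show "smooth_on (in_chart c \<psi>) (chart_image c)" "smooth_on (in_chart c N) (chart_image c)"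
    using assms(3,4,5) by (auto simp: immersion_def unit_normal_def smooth_map_def)
  fix w assume w: "w \<in> chart_image c"
  have top: "inv_into (fst c) (snd c) w \<in> topspace X"
    using in_chart_image(2) [OF w] chart_subset [OF c] by blast
  show "in_chart c \<psi> w \<in> ambient \<epsilon>"
    using assms(3) top unfolding in_chart_image(1) [OF w] immersion_def by blast
  show "inj (\<lambda>u. pd u (in_chart c \<psi>) w)"
    using assms(3,5) w unfolding immersion_def by blast
  show "in_chart c N w \<in> tangent_ambient \<epsilon> (in_chart c \<psi> w)"
    "form \<epsilon> (in_chart c N w) (in_chart c N w) = 1"
    using assms(4) top unfolding in_chart_image(1) [OF w] unit_normal_def by blast+
  show "form \<epsilon> (pd u (in_chart c \<psi>) w) (in_chart c N w) = 0" for u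
    using assms(4,5) w unfolding unit_normal_def by blast
qed

lemma conformal_immersion_in_chart:
  assumes "\<epsilon> \<in> {1, -1}" "smooth_surface X A" "immersion X A \<epsilon> \<psi>" "unit_normal X A \<epsilon> \<psi> N"
    and "constant_curvature A \<epsilon> \<psi> K" "K > 0" "K - \<epsilon> > 0"
    and c: "c \<in> conformal_parameters A B \<epsilon> \<psi> N"
  shows "conformal_immersion (chart_image c) (in_chart c \<psi>) (in_chart c N) \<epsilon> K"
proof -
  have "c \<in> A" using c by (simp add: conformal_parameters_def)
  interpret local_immersion "chart_image c" "in_chart c \<psi>" "in_chart c N" \<epsilon>
    by (rule local_immersion_in_chart) fact+
  have "g = first_form \<epsilon> \<psi> c" by (simp add: fun_eq_iff g_def first_form_def)
  then show ?thesis
    using assms(5-7) c \<open>c \<in> A\<close>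
    by unfold_locales (auto simp: constant_curvature_def conformal_parameters_def second_form_def)
qed

section \<open>Holomorphy of the transitions between conformal parameters\<close>

lemma transition_differentiable:
  assumes "smooth_surface X A" "c \<in> A" "d \<in> A" "w \<in> overlap c d"
  shows "transition c d differentiable at w"
proof -
  have "is_chart X c" "is_chart X d" "smoothly_compatible c d"
    using assms(1-3) by (simp_all add: smooth_surface_def)
  then show ?thesis
    using smooth_on_differentiable [OF _ open_overlap assms(4)] by (auto simp: smoothly_compatible_def)
qed

text \<open>Conformal parameters are compared with the charts of \<open>B\<close> rather than with
  each other. A chart \<open>e\<close> of \<open>B\<close> around the point links them, and
  multiplicativity of the Jacobian transfers the sign.\<close>

lemma conformal_transition_jacobian:
  assumes X: "smooth_surface X A" and B: "orientation X A B"
    and c: "c \<in> conformal_parameters A B \<epsilon> \<psi> N" and d: "d \<in> conformal_parameters A B \<epsilon> \<psi> N"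
    and w: "w \<in> overlap c d"
  shows "jacobian (transition c d) w > 0"
proof -
  have A: "c \<in> A" "d \<in> A" using c d by (simp_all add: conformal_parameters_def)
  then have charts: "is_chart X c" "is_chart X d" using X by (simp_all add: smooth_surface_def)
  note inj = charts [THEN chart_inj]
  obtain p where p: "p \<in> fst c" "p \<in> fst d" "w = snd c p" using w by (auto simp: overlap_def)
  then have "p \<in> (\<Union>e\<in>B. fst e)"
    using B chart_subset [OF charts(1)] unfolding orientation_def by blast
  then obtain e where e: "e \<in> B" "p \<in> fst e" by blast
  have "e \<in> A" using B e by (auto simp: orientation_def)
  have T: "transition c d w = snd d p" using p inj by (simp add: transition_def in_chart_apply)
  have wce: "w \<in> overlap c e" and wde: "transition c d w \<in> overlap d e"
    using p e T by (auto simp: overlap_def)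
  have "transition c e z = transition d e (transition c d z)" if "z \<in> overlap c d" for z
    unfolding transition_def [of _ e] by (rule in_chart_transition [OF inj that])
  then have "pd u (transition c e) w = pd u (\<lambda>z. transition d e (transition c d z)) w" for u
    by (rule pd_cong_open [OF open_overlap [OF charts] w])
  then have "jacobian (transition c e) w = jacobian (\<lambda>z. transition d e (transition c d z)) w"
    by (simp add: jacobian_def)
  also have "\<dots> = jacobian (transition d e) (transition c d w) * jacobian (transition c d) w"
    by (rule jacobian_chain [OF transition_differentiable [OF X A w]
          transition_differentiable [OF X A(2) \<open>e \<in> A\<close> wde]])
  finally have "jacobian (transition c e) w = jacobian (transition d e) (transition c d w) * jacobian (transition c d) w" .
  moreover have "jacobian (transition c e) w > 0"
    using c e wce by (auto simp: conformal_parameters_def positively_compatible_def)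
  moreover have "jacobian (transition d e) (transition c d w) > 0"
    using d e wde by (auto simp: conformal_parameters_def positively_compatible_def)
  ultimately show ?thesis by (simp add: zero_less_mult_iff)
qed

text \<open>II is a tensor, so the transition carries one multiple of the Euclidean product to
  another and its differential is conformal; the positive Jacobian excludes the antiholomorphic
  case.\<close>

lemma conformal_transition_complex_linear:
  assumes "\<epsilon> \<in> {1, -1}" and X: "smooth_surface X A" and B: "orientation X A B"
    and "immersion X A \<epsilon> \<psi>" "unit_normal X A \<epsilon> \<psi> N"
    and c: "c \<in> conformal_parameters A B \<epsilon> \<psi> N" and d: "d \<in> conformal_parameters A B \<epsilon> \<psi> N"
    and w: "w \<in> overlap c d"
  shows "pd \<i> (transition c d) w = \<i> * pd 1 (transition c d) w"
proof -
  let ?T = "transition c d"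
  have A: "c \<in> A" "d \<in> A" using c d by (simp_all add: conformal_parameters_def)
  then have charts: "is_chart X c" "is_chart X d" using X by (simp_all add: smooth_surface_def)
  note inj = charts [THEN chart_inj]
  note Td = transition_differentiable [OF X A w]
  have Tw: "?T w \<in> chart_image d"
    using transition_in_overlap [OF inj(1) w] overlap_subset by blast
  interpret d: local_immersion "chart_image d" "in_chart d \<psi>" "in_chart d N" \<epsilon>
    by (rule local_immersion_in_chart) fact+
  have pd_in_chart: "pd u (in_chart c f) w = pd (pd u ?T w) (in_chart d f) (?T w)"
    if "in_chart d f differentiable at (?T w)" for f :: "'a \<Rightarrow> real ^ 4" and u
    unfolding pd_chain [OF Td that, symmetric]
    by (rule pd_cong_open [OF open_overlap [OF charts] w]) (rule in_chart_transition [OF inj])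
  have II: "second_form \<epsilon> \<psi> N c w u v = second_form \<epsilon> \<psi> N d (?T w) (pd u ?T w) (pd v ?T w)" for u v
    unfolding second_form_def using pd_in_chart d.\<Psi>_diff [OF Tw] d.N_diff [OF Tw] by simp
  obtain r where r: "r \<noteq> 0" "\<And>u v. second_form \<epsilon> \<psi> N c w u v = r * (u \<bullet> v)"
    using c w overlap_subset [of c d] unfolding conformal_parameters_def by blast
  obtain s where s: "s \<noteq> 0" "\<And>u v. second_form \<epsilon> \<psi> N d (?T w) u v = s * (u \<bullet> v)"
    using d Tw unfolding conformal_parameters_def by blast
  have inner: "s * (pd u ?T w \<bullet> pd v ?T w) = r * (u \<bullet> v)" for u v
    using II [of u v] unfolding r(2) s(2) ..
  show ?thesis
  proof (rule conformal_complex_linear)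
    have "s * (pd 1 ?T w \<bullet> pd 1 ?T w) = s * (pd \<i> ?T w \<bullet> pd \<i> ?T w)"
      using inner [of 1 1] inner [of \<i> \<i>] by simp
    then show "pd 1 ?T w \<bullet> pd 1 ?T w = pd \<i> ?T w \<bullet> pd \<i> ?T w" using s(1) by simp
    have "s * (pd 1 ?T w \<bullet> pd \<i> ?T w) = 0" using inner [of 1 \<i>] by simp
    then show "pd 1 ?T w \<bullet> pd \<i> ?T w = 0" using s(1) by simp
    show "Re (pd 1 ?T w) * Im (pd \<i> ?T w) - Im (pd 1 ?T w) * Re (pd \<i> ?T w) > 0"
      using conformal_transition_jacobian [OF X B c d w] by (simp add: jacobian_def)
  qed
qed

theorem corollary1:
  fixes X :: "'a topology" and A B :: "'a chart set"
    and \<psi> N :: "'a \<Rightarrow> real ^ 4" and \<epsilon> K :: real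
  assumes "\<epsilon> \<in> {1, -1}"
    and "smooth_surface X A" and "orientation X A B"
    and "immersion X A \<epsilon> \<psi>" and "unit_normal X A \<epsilon> \<psi> N"
    and "constant_curvature A \<epsilon> \<psi> K" and "K > 0" and "K - \<epsilon> > 0"
  shows "holomorphic_quadratic_form (conformal_parameters A B \<epsilon> \<psi> N)
    (\<lambda>c z. form \<epsilon> (dz_vec (in_chart c \<psi>) z) (dz_vec (in_chart c \<psi>) z) +
       complex_of_real (1 / (\<epsilon> * K - 1)) * (dz (\<lambda>w. of_real (in_chart c (height \<psi>) w)) z)\<^sup>2)"
proof -
  let ?C = "conformal_parameters A B \<epsilon> \<psi> N"
  have height: "in_chart c (height \<psi>) w = in_chart c \<psi> w $ 4" for c :: "'a chart" and w
    by (simp add: in_chart_def height_def)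
  \<comment> \<open>The derivative of the height is the fourth component of \<open>dz_vec\<close>,
    so one transformation rule serves both summands of the coefficient.\<close>
  have nth: "dz (\<lambda>w. complex_of_real (f w $ 4)) z = dz_vec f z $ 4" for f z
    by (simp add: dz_vec_def)
  show ?thesis
    unfolding holomorphic_quadratic_form_def height
  proof (intro conjI ballI)
    fix c assume c: "c \<in> ?C"
    interpret conformal_immersion "chart_image c" "in_chart c \<psi>" "in_chart c N" \<epsilon> K
      by (rule conformal_immersion_in_chart [OF assms(1,2,4-8) c])
    show "(\<lambda>z. form \<epsilon> (dz_vec (in_chart c \<psi>) z) (dz_vec (in_chart c \<psi>) z) +
       complex_of_real (1 / (\<epsilon> * K - 1)) * (dz (\<lambda>w. of_real (in_chart c \<psi> w $ 4)) z)\<^sup>2)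
       holomorphic_on chart_image c"
      by (rule coefficient_holomorphic)
  next
    fix c d assume c: "c \<in> ?C" and d: "d \<in> ?C"
    let ?T = "transition c d"
    have A: "c \<in> A" "d \<in> A" using c d by (simp_all add: conformal_parameters_def)
    then have charts: "is_chart X c" "is_chart X d" using assms(2) by (simp_all add: smooth_surface_def)
    note inj = charts [THEN chart_inj]
    note Td = transition_differentiable [OF assms(2) A]
    note CR = conformal_transition_complex_linear [OF assms(1-5) c d]
    show "?T holomorphic_on overlap c d"
      unfolding holomorphic_on_open [OF open_overlap [OF charts]]
      using has_field_derivative_pd [OF Td CR] by blast
    fix w assume w: "w \<in> overlap c d"
    interpret d: local_immersion "chart_image d" "in_chart d \<psi>" "in_chart d N" \<epsilon>
      by (rule local_immersion_in_chart [OF assms(1,2,4,5) A(2)])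
    have "?T w \<in> chart_image d"
      using transition_in_overlap [OF inj(1) w] overlap_subset by blast
    note diff = d.\<Psi>_diff [OF this]
    have "dz_vec (in_chart c \<psi>) w = dz_vec (\<lambda>z. in_chart d \<psi> (?T z)) w"
      by (rule dz_vec_cong_open [OF open_overlap [OF charts] w]) (rule in_chart_transition [OF inj])
    \<comment> \<open>Each component gains one factor of the derivative of the transition, and the
      coefficient is quadratic in the components, whence the square.\<close>
    then have nth': "dz_vec (in_chart c \<psi>) w $ k = dz_vec (in_chart d \<psi>) (?T w) $ k * deriv ?T w" for k
      using dz_vec_chain [OF Td [OF w] diff CR [OF w]] deriv_pd [OF Td CR, OF w w] by simp
    show "form \<epsilon> (dz_vec (in_chart c \<psi>) w) (dz_vec (in_chart c \<psi>) w) +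
        complex_of_real (1 / (\<epsilon> * K - 1)) * (dz (\<lambda>w. of_real (in_chart c \<psi> w $ 4)) w)\<^sup>2
      = (form \<epsilon> (dz_vec (in_chart d \<psi>) (?T w)) (dz_vec (in_chart d \<psi>) (?T w)) +
        complex_of_real (1 / (\<epsilon> * K - 1)) * (dz (\<lambda>w. of_real (in_chart d \<psi> w $ 4)) (?T w))\<^sup>2)
        * (deriv ?T w)\<^sup>2"
      unfolding nth form_mult_right [OF nth'] nth' by (simp add: power_mult_distrib algebra_simps)
  qed
qed

end
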